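(* Let $D$ be a regular connection on $\pi^{-1}(TM)$ whose (h)hv-torsion tensor $T$ satisfies $T(X,\eta)=0$ for all $\pi$-vector fields $X$. Then for all $\pi$-vector fields $X,Y,Z,W$: (a) $\mathfrak S_{X,Y,Z}\{(D_{\gamma X}S)(Y,Z,W)-S(\widehat S(X,Y),Z)W\}=0$; (b) $(D_{\beta Z}S)(X,Y,W)-(D_{\gamma X}P)(Z,Y,W)+(D_{\gamma Y}P)(Z,X,W)=P(T(X,Z),Y)W-P(T(Y,Z),X)W-P(Z,\widehat S(X,Y))W+S(\widehat P(Z,X),Y)W-S(\widehat P(Z,Y),X)W$; (c) $(D_{\gamma X}R)(Y,Z,W)+(D_{\beta Y}P)(Z,X,W)-(D_{\beta Z}P)(Y,X,W)=P(Z,\widehat P(Y,X))W-P(Y,\widehat P(Z,X))W-P(Q(Y,Z),X)W+R(T(X,Z),Y)W-R(T(X,Y),Z)W+S(\widehat R(Y,Z),X)W$; (d) $\mathfrak S_{X,Y,Z}\{(D_{\beta X}R)(Y,Z,W)+P(X,\widehat R(Y,Z))W+R(Q(X,Y),Z)W\}=0$.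
   Context: $M$ is a real paracompact $C^\infty$ manifold of finite dimension, $\mathcal TM\subset TM$ is the set of nonzero tangent vectors, $\pi:\mathcal TM\to M$ the projection, $\pi^{-1}(TM)\to\mathcal TM$ the pullback of $TM$ by $\pi$; everything is $C^\infty$. Sections of $\pi^{-1}(TM)$ are called $\pi$-vector fields. $\eta$ is the $\pi$-vector field $\eta(u)=(u,u)$. $\rho:T(\mathcal TM)\to\pi^{-1}(TM)$ is $\rho(A)=(u,d\pi(A))$ for $A\in T_u(\mathcal TM)$, and $\gamma:\pi^{-1}(TM)\to T(\mathcal TM)$ is the vertical lift $\gamma(u,v)=\frac{d}{dt}|_{t=0}(u+tv)$; the image of $\gamma$ is the vertical bundle $V=\ker\rho$. For a linear connection $D$ on the vector bundle $\pi^{-1}(TM)$, put $K(A)=D_A\eta$ for $A\in T(\mathcal TM)$ and $H_u=\{A\in T_u(\mathcal TM):K(A)=0\}$. $D$ is regular if $T_u(\mathcal TM)=V_u\oplus H_u$ for all $u$; then $\beta:=(\rho|_H)^{-1}:\pi^{-1}(TM)\to H$ is the horizontal map. For vector fields $A,B,C$ on $\mathcal TM$: torsion $\mathbf T(A,B)=D_A\rho B-D_B\rho A-\rho[A,B]$; curvature (note the sign) $\mathbf K(A,B)\rho C=-D_AD_B\rho C+D_BD_A\rho C+D_{[A,B]}\rho C$. For $\pi$-vector fields: $Q(X,Y)=\mathbf T(\beta X,\beta Y)$ ((h)h-torsion), $T(X,Y)=\mathbf T(\gamma X,\beta Y)$ ((h)hv-torsion), $R(X,Y)Z=\mathbf K(\beta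 X,\beta Y)Z$, $P(X,Y)Z=\mathbf K(\beta X,\gamma Y)Z$, $S(X,Y)Z=\mathbf K(\gamma X,\gamma Y)Z$, and $\widehat R(X,Y)=R(X,Y)\eta$, $\widehat P(X,Y)=P(X,Y)\eta$, $\widehat S(X,Y)=S(X,Y)\eta$. For $B\in\{R,P,S\}$ and a vector field $A$ on $\mathcal TM$, $(D_AB)(X,Y,Z)=D_A(B(X,Y)Z)-B(D_AX,Y)Z-B(X,D_AY)Z-B(X,Y)D_AZ$ (a $\pi$-vector field). $\mathfrak S_{X,Y,Z}$ denotes the cyclic sum over $X,Y,Z$. *)

theory Defs
  imports "HOL-Analysis.Analysis" "HOL-Library.Function_Algebras"
begin

instantiation "fun" :: (type, real_vector) real_vector
begin

definition scaleR_fun :: "real \<Rightarrow> ('a \<Rightarrow> 'b) \<Rightarrow> 'a \<Rightarrow> 'b"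
  where "scaleR_fun c f = (\<lambda>x. c *\<^sub>R f x)"

instance
  by standard (auto simp: scaleR_fun_def fun_eq_iff scaleR_add_right scaleR_add_left)

end

text \<open>Only used for open sets of Euclidean spaces, where a function is of class $C^{k+1}$ iff
  it is differentiable and all its directional derivatives are of class $C^k$.\<close>

fun Ck_on :: "nat \<Rightarrow> 'a::real_normed_vector set \<Rightarrow> ('a \<Rightarrow> 'b::real_normed_vector) \<Rightarrow> bool" where
  "Ck_on 0 S f \<longleftrightarrow> continuous_on S f"
| "Ck_on (Suc k) S f \<longleftrightarrow>
     (\<forall>x\<in>S. f differentiable (at x)) \<and> (\<forall>v. Ck_on k S (\<lambda>x. frechet_derivative f (at x) v))"

definition smooth_on :: "'a::real_normed_vector set \<Rightarrow> ('a \<Rightarrow> 'b::real_normed_vector) \<Rightarrow> bool"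
  where "smooth_on S f \<longleftrightarrow> (\<forall>k. Ck_on k S f)"

text \<open>Charts are indexed by \<open>indices\<close>; the atlas need not be maximal.\<close>

record ('a, 'i, 'e) charted_set =
  points :: "'a set"
  indices :: "'i set"
  domain :: "'i \<Rightarrow> 'a set"
  coord :: "'i \<Rightarrow> 'a \<Rightarrow> 'e"

definition chart_inv :: "('a, 'i, 'e) charted_set \<Rightarrow> 'i \<Rightarrow> 'e \<Rightarrow> 'a"
  where "chart_inv M i = inv_into (domain M i) (coord M i)"

definition chart_image :: "('a, 'i, 'e) charted_set \<Rightarrow> 'i \<Rightarrow> 'e set"
  where "chart_image M i = coord M i ` domain M i"

definition transition :: "('a, 'i, 'e) charted_set \<Rightarrow> 'i \<Rightarrow> 'i \<Rightarrow> 'e \<Rightarrow> 'e"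
  where "transition M i j = coord M j \<circ> chart_inv M i"

definition charts_at :: "('a, 'i, 'e) charted_set \<Rightarrow> 'a \<Rightarrow> 'i set"
  where "charts_at M p = {i \<in> indices M. p \<in> domain M i}"

definition smooth_atlas :: "('a, 'i, 'e::euclidean_space) charted_set \<Rightarrow> bool"
  where "smooth_atlas M \<longleftrightarrow>
    (\<Union>i\<in>indices M. domain M i) = points M \<and>
    (\<forall>i\<in>indices M. inj_on (coord M i) (domain M i)) \<and>
    (\<forall>i\<in>indices M. \<forall>j\<in>indices M.
       open (coord M i ` (domain M i \<inter> domain M j)) \<and>
       smooth_on (coord M i ` (domain M i \<inter> domain M j)) (transition M i j))"

text \<open>The unique topology for which all chart domains are open and all charts are homeomorphisms
  onto open subsets of the model space.\<close>

definition manifold_topology :: "('a, 'i, 'e::euclidean_space) charted_set \<Rightarrow> 'a topology"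
  where "manifold_topology M = topology (\<lambda>U. U \<subseteq> points M \<and>
    (\<forall>i\<in>indices M. open (coord M i ` (U \<inter> domain M i))))"

lemma openin_manifold_topology:
  assumes M: "smooth_atlas M"
  shows "openin (manifold_topology M) U \<longleftrightarrow>
    U \<subseteq> points M \<and> (\<forall>i\<in>indices M. open (coord M i ` (U \<inter> domain M i)))"
proof -
  have inj: "inj_on (coord M i) (domain M i)" if "i \<in> indices M" for i
    using M that by (auto simp: smooth_atlas_def)
  have "istopology (\<lambda>U. U \<subseteq> points M \<and>
    (\<forall>i\<in>indices M. open (coord M i ` (U \<inter> domain M i))))"
    unfolding istopology_def
  proof (intro conjI allI impI)
    fix S T
    assume S: "S \<subseteq> points M \<and> (\<forall>i\<in>indices M. open (coord M i ` (S \<inter> domain M i)))"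
      and T: "T \<subseteq> points M \<and> (\<forall>i\<in>indices M. open (coord M i ` (T \<inter> domain M i)))"
    show "S \<inter> T \<subseteq> points M" using S by auto
    show "\<forall>i\<in>indices M. open (coord M i ` (S \<inter> T \<inter> domain M i))"
    proof
      fix i assume i: "i \<in> indices M"
      have "coord M i ` (S \<inter> T \<inter> domain M i) =
          coord M i ` (S \<inter> domain M i) \<inter> coord M i ` (T \<inter> domain M i)"
        using inj[OF i] by (auto simp: inj_on_def)
      then show "open (coord M i ` (S \<inter> T \<inter> domain M i))"
        using S T i by auto
    qed
  next
    fix \<K>
    assume K: "\<forall>K\<in>\<K>. K \<subseteq> points M \<and> (\<forall>i\<in>indices M. open (coord M i ` (K \<inter> domain M i)))"
    show "\<Union>\<K> \<subseteq> points M" using K by auto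
    show "\<forall>i\<in>indices M. open (coord M i ` (\<Union>\<K> \<inter> domain M i))"
    proof
      fix i assume i: "i \<in> indices M"
      have "coord M i ` (\<Union>\<K> \<inter> domain M i) = (\<Union>K\<in>\<K>. coord M i ` (K \<inter> domain M i))"
        by auto
      then show "open (coord M i ` (\<Union>\<K> \<inter> domain M i))"
        using K i by auto
    qed
  qed
  then show ?thesis
    by (simp add: manifold_topology_def)
qed

definition paracompact_topology :: "'a topology \<Rightarrow> bool"
  where "paracompact_topology X \<longleftrightarrow>
    (\<forall>\<U>. (\<forall>U\<in>\<U>. openin X U) \<and> \<Union>\<U> = topspace X \<longrightarrow>
      (\<exists>\<V>. (\<forall>V\<in>\<V>. openin X V \<and> (\<exists>U\<in>\<U>. V \<subseteq> U)) \<and> \<Union>\<V> = topspace X \<and>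
        locally_finite_in X \<V>))"

definition paracompact_smooth_manifold :: "('a, 'i, 'e::euclidean_space) charted_set \<Rightarrow> bool"
  where "paracompact_smooth_manifold M \<longleftrightarrow>
    smooth_atlas M \<and> Hausdorff_space (manifold_topology M) \<and>
    paracompact_topology (manifold_topology M)"

text \<open>A tangent vector at \<open>p\<close> is the family of its coordinate representations in the charts
  around \<open>p\<close>, related by the derivatives of the transition maps; the entries at all other indices
  are set to \<open>0\<close>, so that the vector space operations are the pointwise ones.\<close>

definition tangent_space ::
    "('a, 'i, 'e::euclidean_space) charted_set \<Rightarrow> 'a \<Rightarrow> ('i \<Rightarrow> 'e) set"
  where "tangent_space M p = {v.
    (\<forall>i. i \<notin> charts_at M p \<longrightarrow> v i = 0) \<and>
    (\<forall>i\<in>charts_at M p. \<forall>j\<in>charts_at M p.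
       v j = frechet_derivative (transition M i j) (at (coord M i p)) (v i))}"

text \<open>The tangent vector at \<open>p\<close> whose representation in chart \<open>i\<close> is \<open>w\<close>.\<close>

definition coord_vector ::
    "('a, 'i, 'e::euclidean_space) charted_set \<Rightarrow> 'i \<Rightarrow> 'a \<Rightarrow> 'e \<Rightarrow> 'i \<Rightarrow> 'e"
  where "coord_vector M i p w = (\<lambda>j. if j \<in> charts_at M p
    then frechet_derivative (transition M i j) (at (coord M i p)) w else 0)"

text \<open>The next two do not depend on the chosen chart when \<open>A\<close> is a tangent vector at \<open>p\<close> and \<open>f\<close>
  is smooth. The velocity of a curve is taken at time \<open>0\<close>.\<close>

definition directional_derivative ::
    "('a, 'i, 'e::euclidean_space) charted_set \<Rightarrow> 'a \<Rightarrow> ('i \<Rightarrow> 'e) \<Rightarrow> ('a \<Rightarrow> real) \<Rightarrow> real"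
  where "directional_derivative M p A f = (let i = (SOME i. i \<in> charts_at M p) in
    frechet_derivative (f \<circ> chart_inv M i) (at (coord M i p)) (A i))"

definition differential ::
    "('a, 'i, 'e::euclidean_space) charted_set \<Rightarrow> ('b, 'j, 'f::euclidean_space) charted_set \<Rightarrow>
     ('a \<Rightarrow> 'b) \<Rightarrow> 'a \<Rightarrow> ('i \<Rightarrow> 'e) \<Rightarrow> 'j \<Rightarrow> 'f"
  where "differential M N f p A = (let i = (SOME i. i \<in> charts_at M p) in
    (\<lambda>j. if j \<in> charts_at N (f p)
      then frechet_derivative (coord N j \<circ> f \<circ> chart_inv M i) (at (coord M i p)) (A i) else 0))"

definition velocity ::
    "('a, 'i, 'e::euclidean_space) charted_set \<Rightarrow> (real \<Rightarrow> 'a) \<Rightarrow> 'i \<Rightarrow> 'e"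
  where "velocity M c = (\<lambda>i. if i \<in> charts_at M (c 0)
    then vector_derivative (coord M i \<circ> c) (at 0) else 0)"

definition smooth_function :: "('a, 'i, 'e::euclidean_space) charted_set \<Rightarrow> ('a \<Rightarrow> real) \<Rightarrow> bool"
  where "smooth_function M f \<longleftrightarrow>
    (\<forall>i\<in>indices M. smooth_on (chart_image M i) (f \<circ> chart_inv M i))"

definition vector_field ::
    "('a, 'i, 'e::euclidean_space) charted_set \<Rightarrow> ('a \<Rightarrow> 'i \<Rightarrow> 'e) \<Rightarrow> bool"
  where "vector_field M A \<longleftrightarrow> (\<forall>p\<in>points M. A p \<in> tangent_space M p) \<and>
    (\<forall>i\<in>indices M. smooth_on (chart_image M i) (\<lambda>x. A (chart_inv M i x) i))"

text \<open>Sign convention: \<open>[A,B]f = A(Bf) - B(Af)\<close>.\<close>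

definition lie_bracket ::
    "('a, 'i, 'e::euclidean_space) charted_set \<Rightarrow>
     ('a \<Rightarrow> 'i \<Rightarrow> 'e) \<Rightarrow> ('a \<Rightarrow> 'i \<Rightarrow> 'e) \<Rightarrow> 'a \<Rightarrow> 'i \<Rightarrow> 'e"
  where "lie_bracket M A B p = (\<lambda>i. if i \<in> charts_at M p
    then frechet_derivative (\<lambda>x. B (chart_inv M i x) i) (at (coord M i p)) (A p i)
       - frechet_derivative (\<lambda>x. A (chart_inv M i x) i) (at (coord M i p)) (B p i)
    else 0)"

type_synonym ('a, 'i, 'e) tangent_point = "'a \<times> ('i \<Rightarrow> 'e)"

definition slit_tangent_bundle ::
    "('a, 'i, 'e::euclidean_space) charted_set \<Rightarrow>
     (('a, 'i, 'e) tangent_point, 'i, 'e \<times> 'e) charted_set"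
  where "slit_tangent_bundle M = \<lparr>
    points = {(p, v). p \<in> points M \<and> v \<in> tangent_space M p \<and> v \<noteq> 0},
    indices = indices M,
    domain = (\<lambda>i. {(p, v). p \<in> domain M i \<and> v \<in> tangent_space M p \<and> v \<noteq> 0}),
    coord = (\<lambda>i (p, v). (coord M i p, v i))\<rparr>"

text \<open>The fibre of the pullback bundle over \<open>u\<close> is \<open>{u} \<times> T\<^bsub>\<pi>(u)\<^esub>M\<close>, where \<open>\<pi>\<close> is \<open>fst\<close>. We
  suppress the component \<open>u\<close>: elements of the fibre are tangent vectors at \<open>fst u\<close>, and sections
  are given by their second components. Smoothness is expressed in the local trivialisations
  induced by the charts.\<close>

type_synonym ('a, 'i, 'e) pi_section = "('a, 'i, 'e) tangent_point \<Rightarrow> 'i \<Rightarrow> 'e"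

type_synonym ('a, 'i, 'e) slit_field = "('a, 'i, 'e) tangent_point \<Rightarrow> 'i \<Rightarrow> 'e \<times> 'e"

definition pi_vector_field ::
    "('a, 'i, 'e::euclidean_space) charted_set \<Rightarrow> ('a, 'i, 'e) pi_section \<Rightarrow> bool"
  where "pi_vector_field M X \<longleftrightarrow>
    (\<forall>u\<in>points (slit_tangent_bundle M). X u \<in> tangent_space M (fst u)) \<and>
    (\<forall>i\<in>indices M. smooth_on (chart_image (slit_tangent_bundle M) i)
       (\<lambda>x. X (chart_inv (slit_tangent_bundle M) i x) i))"

definition eta :: "('a, 'i, 'e) pi_section"
  where "eta u = snd u"

definition rho ::
    "('a, 'i, 'e::euclidean_space) charted_set \<Rightarrow> ('a, 'i, 'e) tangent_point \<Rightarrow>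
     ('i \<Rightarrow> 'e \<times> 'e) \<Rightarrow> 'i \<Rightarrow> 'e"
  where "rho M u = differential (slit_tangent_bundle M) M fst u"

definition vertical_lift ::
    "('a, 'i, 'e::euclidean_space) charted_set \<Rightarrow> ('a, 'i, 'e) tangent_point \<Rightarrow>
     ('i \<Rightarrow> 'e) \<Rightarrow> 'i \<Rightarrow> 'e \<times> 'e"
  where "vertical_lift M u v =
    velocity (slit_tangent_bundle M) (\<lambda>t. (fst u, snd u + t *\<^sub>R v))"

definition vertical_space ::
    "('a, 'i, 'e::euclidean_space) charted_set \<Rightarrow> ('a, 'i, 'e) tangent_point \<Rightarrow>
     ('i \<Rightarrow> 'e \<times> 'e) set"
  where "vertical_space M u = {A \<in> tangent_space (slit_tangent_bundle M) u. rho M u A = 0}"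

definition rho_field ::
    "('a, 'i, 'e::euclidean_space) charted_set \<Rightarrow> ('a, 'i, 'e) slit_field \<Rightarrow>
     ('a, 'i, 'e) pi_section"
  where "rho_field M A = (\<lambda>u. rho M u (A u))"

definition gamma_field ::
    "('a, 'i, 'e::euclidean_space) charted_set \<Rightarrow> ('a, 'i, 'e) pi_section \<Rightarrow>
     ('a, 'i, 'e) slit_field"
  where "gamma_field M X = (\<lambda>u. vertical_lift M u (X u))"

text \<open>\<open>D u A X\<close> stands for \<open>D\<^sub>A X\<close>, for \<open>A\<close> tangent to the slit tangent bundle at \<open>u\<close> and \<open>X\<close> a
  section of the pullback bundle.\<close>

type_synonym ('a, 'i, 'e) pi_operator =
  "('a, 'i, 'e) tangent_point \<Rightarrow> ('i \<Rightarrow> 'e \<times> 'e) \<Rightarrow> ('a, 'i, 'e) pi_section \<Rightarrow> 'i \<Rightarrow> 'e"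

text \<open>The first condition only says that values of the HOL function \<open>X\<close> at arguments outside the
  slit tangent bundle are irrelevant. The last one says that \<open>D X\<close> is a smooth one-form with
  values in the pullback bundle, i.e. its components in every chart are smooth.\<close>

definition linear_connection ::
    "('a, 'i, 'e::euclidean_space) charted_set \<Rightarrow> ('a, 'i, 'e) pi_operator \<Rightarrow> bool"
  where "linear_connection M D \<longleftrightarrow> (let N = slit_tangent_bundle M in
    (\<forall>X Y. pi_vector_field M X \<and> (\<forall>u\<in>points N. X u = Y u) \<longrightarrow>
       (\<forall>u\<in>points N. \<forall>A\<in>tangent_space N u. D u A X = D u A Y)) \<and>
    (\<forall>X u A. pi_vector_field M X \<and> u \<in> points N \<and> A \<in> tangent_space N u \<longrightarrow>
       D u A X \<in> tangent_space M (fst u)) \<and>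
    (\<forall>X u A B. pi_vector_field M X \<and> u \<in> points N \<and> A \<in> tangent_space N u \<and>
       B \<in> tangent_space N u \<longrightarrow> D u (A + B) X = D u A X + D u B X) \<and>
    (\<forall>X u A c. pi_vector_field M X \<and> u \<in> points N \<and> A \<in> tangent_space N u \<longrightarrow>
       D u (c *\<^sub>R A) X = c *\<^sub>R D u A X) \<and>
    (\<forall>X Y u A. pi_vector_field M X \<and> pi_vector_field M Y \<and> u \<in> points N \<and>
       A \<in> tangent_space N u \<longrightarrow> D u A (X + Y) = D u A X + D u A Y) \<and>
    (\<forall>f X u A. smooth_function N f \<and> pi_vector_field M X \<and> u \<in> points N \<and>
       A \<in> tangent_space N u \<longrightarrow>
       D u A (\<lambda>w. f w *\<^sub>R X w) = directional_derivative N u A f *\<^sub>R X u + f u *\<^sub>R D u A X) \<and>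
    (\<forall>X. pi_vector_field M X \<longrightarrow> (\<forall>i\<in>indices N. \<forall>e. smooth_on (chart_image N i)
       (\<lambda>x. D (chart_inv N i x) (coord_vector N i (chart_inv N i x) e) X i))))"

definition cov ::
    "('a, 'i, 'e) pi_operator \<Rightarrow> ('a, 'i, 'e) slit_field \<Rightarrow> ('a, 'i, 'e) pi_section \<Rightarrow>
     ('a, 'i, 'e) pi_section"
  where "cov D A X = (\<lambda>u. D u (A u) X)"

definition deflection ::
    "('a, 'i, 'e) pi_operator \<Rightarrow> ('a, 'i, 'e) tangent_point \<Rightarrow> ('i \<Rightarrow> 'e \<times> 'e) \<Rightarrow> 'i \<Rightarrow> 'e"
  where "deflection D u A = D u A eta"

definition horizontal_space ::
    "('a, 'i, 'e::euclidean_space) charted_set \<Rightarrow> ('a, 'i, 'e) pi_operator \<Rightarrow>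
     ('a, 'i, 'e) tangent_point \<Rightarrow> ('i \<Rightarrow> 'e \<times> 'e) set"
  where "horizontal_space M D u =
    {A \<in> tangent_space (slit_tangent_bundle M) u. deflection D u A = 0}"

definition regular_connection ::
    "('a, 'i, 'e::euclidean_space) charted_set \<Rightarrow> ('a, 'i, 'e) pi_operator \<Rightarrow> bool"
  where "regular_connection M D \<longleftrightarrow> linear_connection M D \<and>
    (\<forall>u\<in>points (slit_tangent_bundle M).
       (\<forall>A\<in>tangent_space (slit_tangent_bundle M) u.
          \<exists>B\<in>vertical_space M u. \<exists>C\<in>horizontal_space M D u. A = B + C) \<and>
       vertical_space M u \<inter> horizontal_space M D u = {0})"

definition horizontal_lift ::
    "('a, 'i, 'e::euclidean_space) charted_set \<Rightarrow> ('a, 'i, 'e) pi_operator \<Rightarrow>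
     ('a, 'i, 'e) tangent_point \<Rightarrow> ('i \<Rightarrow> 'e) \<Rightarrow> 'i \<Rightarrow> 'e \<times> 'e"
  where "horizontal_lift M D u = the_inv_into (horizontal_space M D u) (rho M u)"

definition beta_field ::
    "('a, 'i, 'e::euclidean_space) charted_set \<Rightarrow> ('a, 'i, 'e) pi_operator \<Rightarrow>
     ('a, 'i, 'e) pi_section \<Rightarrow> ('a, 'i, 'e) slit_field"
  where "beta_field M D X = (\<lambda>u. horizontal_lift M D u (X u))"

definition torsion ::
    "('a, 'i, 'e::euclidean_space) charted_set \<Rightarrow> ('a, 'i, 'e) pi_operator \<Rightarrow>
     ('a, 'i, 'e) slit_field \<Rightarrow> ('a, 'i, 'e) slit_field \<Rightarrow> ('a, 'i, 'e) pi_section"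
  where "torsion M D A B = cov D A (rho_field M B) - cov D B (rho_field M A)
    - rho_field M (lie_bracket (slit_tangent_bundle M) A B)"

text \<open>\<open>Z\<close> plays the role of \<open>\<rho>C\<close>; the sign is opposite to the more common convention.\<close>

definition curvature ::
    "('a, 'i, 'e::euclidean_space) charted_set \<Rightarrow> ('a, 'i, 'e) pi_operator \<Rightarrow>
     ('a, 'i, 'e) slit_field \<Rightarrow> ('a, 'i, 'e) slit_field \<Rightarrow> ('a, 'i, 'e) pi_section \<Rightarrow>
     ('a, 'i, 'e) pi_section"
  where "curvature M D A B Z = - cov D A (cov D B Z) + cov D B (cov D A Z)
    + cov D (lie_bracket (slit_tangent_bundle M) A B) Z"

type_synonym ('a, 'i, 'e) torsion_tensor =
  "('a, 'i, 'e) pi_section \<Rightarrow> ('a, 'i, 'e) pi_section \<Rightarrow> ('a, 'i, 'e) pi_section"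

type_synonym ('a, 'i, 'e) curvature_tensor =
  "('a, 'i, 'e) pi_section \<Rightarrow> ('a, 'i, 'e) pi_section \<Rightarrow> ('a, 'i, 'e) pi_section \<Rightarrow>
   ('a, 'i, 'e) pi_section"

definition h_torsion ::
    "('a, 'i, 'e::euclidean_space) charted_set \<Rightarrow> ('a, 'i, 'e) pi_operator \<Rightarrow>
     ('a, 'i, 'e) torsion_tensor"
  where "h_torsion M D X Y = torsion M D (beta_field M D X) (beta_field M D Y)"

definition hv_torsion ::
    "('a, 'i, 'e::euclidean_space) charted_set \<Rightarrow> ('a, 'i, 'e) pi_operator \<Rightarrow>
     ('a, 'i, 'e) torsion_tensor"
  where "hv_torsion M D X Y = torsion M D (gamma_field M X) (beta_field M D Y)"

definition h_curvature ::
    "('a, 'i, 'e::euclidean_space) charted_set \<Rightarrow> ('a, 'i, 'e) pi_operator \<Rightarrow>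
     ('a, 'i, 'e) curvature_tensor"
  where "h_curvature M D X Y Z = curvature M D (beta_field M D X) (beta_field M D Y) Z"

definition hv_curvature ::
    "('a, 'i, 'e::euclidean_space) charted_set \<Rightarrow> ('a, 'i, 'e) pi_operator \<Rightarrow>
     ('a, 'i, 'e) curvature_tensor"
  where "hv_curvature M D X Y Z = curvature M D (beta_field M D X) (gamma_field M Y) Z"

definition v_curvature ::
    "('a, 'i, 'e::euclidean_space) charted_set \<Rightarrow> ('a, 'i, 'e) pi_operator \<Rightarrow>
     ('a, 'i, 'e) curvature_tensor"
  where "v_curvature M D X Y Z = curvature M D (gamma_field M X) (gamma_field M Y) Z"

definition hat :: "('a, 'i, 'e) curvature_tensor \<Rightarrow> ('a, 'i, 'e) torsion_tensor"
  where "hat B X Y = B X Y eta"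

definition cov_tensor ::
    "('a, 'i, 'e) pi_operator \<Rightarrow> ('a, 'i, 'e) slit_field \<Rightarrow>
     ('a, 'i, 'e::euclidean_space) curvature_tensor \<Rightarrow> ('a, 'i, 'e) curvature_tensor"
  where "cov_tensor D A B X Y Z =
    cov D A (B X Y Z) - B (cov D A X) Y Z - B X (cov D A Y) Z - B X Y (cov D A Z)"

definition cyclic_sum :: "('s \<Rightarrow> 's \<Rightarrow> 's \<Rightarrow> 't::plus) \<Rightarrow> 's \<Rightarrow> 's \<Rightarrow> 's \<Rightarrow> 't"
  where "cyclic_sum F X Y Z = F X Y Z + F Y Z X + F Z X Y"

end

theory Submission
  imports Defs
begin

text \<open>All four identities are components of the second Bianchi identity of the curvature \<open>K\<close> of a
  connection on a vector bundle,
  \<open>\<Sum> {D\<^sub>A K(B,C)W - K(B,C)D\<^sub>A W - K([A,B],C)W} = 0\<close>,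
  where \<open>\<Sum>\<close> is the cyclic sum over \<open>A, B, C\<close>; it follows from the Jacobi
  identity. One inserts vertical fields \<open>\<gamma>X\<close> and horizontal fields \<open>\<beta>X\<close> for \<open>A, B, C\<close>. The condition \<open>T(X,\<eta>) = 0\<close> says \<open>D\<^bsub>\<gamma>X\<^esub>\<eta> = X\<close>, because \<open>\<rho>[\<gamma>X,\<beta>\<eta>] = X\<close>. Hence
  every field decomposes as \<open>A = \<gamma>(D\<^sub>A\<eta>) + \<beta>(\<rho>A)\<close>; for a bracket \<open>A\<close>, the two parts are expressed by
  the curvature applied to \<open>\<eta>\<close> and by the torsion.

  The analytic point is the smoothness of \<open>\<beta>X\<close>: locally it is given by the inverse of a smooth
  family of linear maps.\<close>

section \<open>Smooth functions\<close>

text \<open>The tensors S, P, R take \<pi>-vector fields, so the terms K([A,B],C)W have to be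
  rewritten with fields \<gamma>X and \<beta>X. Read for its bracket term, the definition of
  K(A,B)\<eta> says that the derivative of \<eta> along [A,B] is K(A,B)\<eta> + D_A D_B \<eta> - D_B
  D_A \<eta>; the definition of torsion says that \<rho>[A,B] is D_A \<rho>B - D_B \<rho>A minus the
  torsion of A and B. If A and B are of the form \<gamma>X or \<beta>X, then D_A \<eta> and \<rho>A
  are X or 0. So the curvature and torsion parts are the hatted tensors and Q, T, while the
  remaining terms, such as D_A Y, are exactly the corrections that turn D_A(K(B,C)W) into the
  derivative of a tensor. Fields and sections are total functions whose values matter on the slit
  bundle only, hence the congruence lemmas. The connection acts on global sections; smoothness of
  D_A X is obtained in charts by regarding DX as a family of linear maps that is smooth on each
  fixed vector.\<close>

lemma smooth_on_imp_Ck_on: "smooth_on S f \<Longrightarrow> Ck_on k S f"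
  by (simp add: smooth_on_def)

lemma smooth_on_imp_differentiable: "smooth_on S f \<Longrightarrow> x \<in> S \<Longrightarrow> f differentiable (at x)"
  using smooth_on_imp_Ck_on[of S f "Suc 0"] by simp

lemma smooth_on_imp_has_derivative:
  "smooth_on S f \<Longrightarrow> x \<in> S \<Longrightarrow> (f has_derivative frechet_derivative f (at x)) (at x)"
  by (simp add: frechet_derivative_works[symmetric] smooth_on_imp_differentiable)

lemma smooth_on_imp_continuous_on: "smooth_on S f \<Longrightarrow> continuous_on S f"
  using smooth_on_imp_Ck_on[of S f 0] by simp

lemma smooth_on_derivative: "smooth_on S f \<Longrightarrow> smooth_on S (\<lambda>x. frechet_derivative f (at x) v)"
  unfolding smooth_on_def
proof
  fix k assume "\<forall>k. Ck_on k S f"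
  then have "Ck_on (Suc k) S f" by blast
  then show "Ck_on k S (\<lambda>x. frechet_derivative f (at x) v)" by simp
qed

lemma Ck_on_subset: "Ck_on k S f \<Longrightarrow> T \<subseteq> S \<Longrightarrow> Ck_on k T f"
  by (induction k arbitrary: f) (auto intro: continuous_on_subset)

lemma smooth_on_subset: "smooth_on S f \<Longrightarrow> T \<subseteq> S \<Longrightarrow> smooth_on T f"
  by (auto simp: smooth_on_def intro: Ck_on_subset)

lemma Ck_on_Suc_imp_Ck_on: "Ck_on (Suc k) S f \<Longrightarrow> Ck_on k S f"
proof (induction k arbitrary: f)
  case 0
  then show ?case
    by (auto intro!: continuous_at_imp_continuous_on differentiable_imp_continuous_within)
next
  case (Suc k)
  then show ?case by (metis Ck_on.simps(2))
qed

text \<open>Being a derivative at \<open>x\<close> depends only on the values near \<open>x\<close>,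
  so the choice operator behind \<open>frechet_derivative\<close> selects the same map for
  \<open>f\<close> and \<open>g\<close>, even where neither is differentiable.\<close>

lemma frechet_derivative_cong_open:
  assumes "open S" "x \<in> S" "\<And>x. x \<in> S \<Longrightarrow> f x = g x"
  shows "frechet_derivative f (at x) = frechet_derivative g (at x)"
proof -
  have "(f has_derivative D) (at x) \<longleftrightarrow> (g has_derivative D) (at x)" for D
    using has_derivative_transform_within_open[OF _ assms(1,2), of f D UNIV g]
      has_derivative_transform_within_open[OF _ assms(1,2), of g D UNIV f] assms(3) by auto
  then show ?thesis by (simp add: frechet_derivative_def)
qed

lemma Ck_on_cong:
  assumes "open S" "\<And>x. x \<in> S \<Longrightarrow> f x = g x"
  shows "Ck_on k S f \<longleftrightarrow> Ck_on k S g"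
  using assms(2)
proof (induction k arbitrary: f g)
  case 0
  then show ?case by (simp cong: continuous_on_cong)
next
  case (Suc k)
  have "f differentiable (at x) \<longleftrightarrow> g differentiable (at x)" if "x \<in> S" for x
    using Suc.prems that assms(1) unfolding differentiable_def
    by (metis has_derivative_transform_within_open)
  moreover have "Ck_on k S (\<lambda>x. frechet_derivative f (at x) v) \<longleftrightarrow>
      Ck_on k S (\<lambda>x. frechet_derivative g (at x) v)" for v
    by (rule Suc.IH) (simp add: frechet_derivative_cong_open[OF assms(1) _ Suc.prems])
  ultimately show ?case by auto
qed

lemma smooth_on_cong:
  assumes "open S" "\<And>x. x \<in> S \<Longrightarrow> f x = g x"
  shows "smooth_on S f \<longleftrightarrow> smooth_on S g"
  unfolding smooth_on_def using Ck_on_cong[OF assms(1), of f g] assms(2) by simp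

text \<open>Lets an explicit derivative formula replace \<open>frechet_derivative\<close>; the
  closure properties below are proved in this form, by induction on the order.\<close>

lemma Ck_on_SucI:
  assumes "open S" "\<And>x. x \<in> S \<Longrightarrow> (f has_derivative f' x) (at x)"
    "\<And>v. Ck_on k S (\<lambda>x. f' x v)"
  shows "Ck_on (Suc k) S f"
proof -
  have "f' x = frechet_derivative f (at x)" if "x \<in> S" for x
    using assms(2) that by (simp add: frechet_derivative_at)
  then have "Ck_on k S (\<lambda>x. frechet_derivative f (at x) v)" for v
    using Ck_on_cong[OF assms(1), of "\<lambda>x. f' x v" "\<lambda>x. frechet_derivative f (at x) v" k] assms(3)
    by metis
  then show ?thesis using assms(2) by (auto simp: differentiable_def)
qed

lemma Ck_on_SucD:
  assumes "Ck_on (Suc k) S f"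
  shows "\<And>x. x \<in> S \<Longrightarrow> (f has_derivative frechet_derivative f (at x)) (at x)"
    and "Ck_on k S (\<lambda>x. frechet_derivative f (at x) v)"
  using assms by (auto simp: frechet_derivative_works)

lemma Ck_on_const: "Ck_on k S (\<lambda>x. c)"
  by (induction k arbitrary: c) auto

lemma Ck_on_add:
  assumes "open S" "Ck_on k S f" "Ck_on k S g"
  shows "Ck_on k S (\<lambda>x. f x + g x)"
  using assms(2,3)
proof (induction k arbitrary: f g)
  case 0
  then show ?case by (simp add: continuous_on_add)
next
  case (Suc k)
  note f = Ck_on_SucD[OF Suc.prems(1)] and g = Ck_on_SucD[OF Suc.prems(2)]
  show ?case
    by (rule Ck_on_SucI[OF assms(1) has_derivative_add[OF f(1) g(1)]]) (auto intro: Suc.IH f g)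
qed

text \<open>By the product rule each term of the derivative pairs a derivative of class
  \<open>k\<close> with an undifferentiated factor, whose class is lowered from \<open>Suc k\<close>
  to \<open>k\<close>.\<close>

lemma Ck_on_bounded_bilinear:
  assumes "bounded_bilinear p" "open S" "Ck_on k S f" "Ck_on k S g"
  shows "Ck_on k S (\<lambda>x. p (f x) (g x))"
  using assms(3,4)
proof (induction k arbitrary: f g)
  case 0
  then show ?case using bounded_bilinear.continuous_on[OF assms(1)] by simp
next
  case (Suc k)
  note f = Ck_on_SucD[OF Suc.prems(1)] and g = Ck_on_SucD[OF Suc.prems(2)]
  show ?case
    by (rule Ck_on_SucI[OF assms(2) bounded_bilinear.FDERIV[OF assms(1) f(1) g(1)]])
      (assumption | intro Ck_on_add assms(2) Suc.IH f g Suc.prems[THEN Ck_on_Suc_imp_Ck_on])+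
qed

lemma Ck_on_bounded_linear_comp:
  assumes "bounded_linear L" "open S" "Ck_on k S f"
  shows "Ck_on k S (\<lambda>x. L (f x))"
  using assms(3)
proof (induction k arbitrary: f)
  case 0
  then show ?case using bounded_linear.continuous_on[OF assms(1)] by simp
next
  case (Suc k)
  note f = Ck_on_SucD[OF Suc.prems]
  show ?case
    by (rule Ck_on_SucI[OF assms(2) bounded_linear.has_derivative[OF assms(1) f(1)]])
      (auto intro!: Suc.IH f)
qed

text \<open>Differentiating \<open>f (L x)\<close> along \<open>v\<close> gives again a function of
  \<open>L x\<close>, namely the derivative of \<open>f\<close> along \<open>L v\<close>, so the
  induction closes. It is applied to the projection of a bundle chart onto its base
  coordinates.\<close>

lemma Ck_on_comp_bounded_linear:
  assumes "bounded_linear L" "open T" "L ` T \<subseteq> S" "Ck_on k S f"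
  shows "Ck_on k T (\<lambda>x. f (L x))"
  using assms(4)
proof (induction k arbitrary: f)
  case 0
  then have "continuous_on (L ` T) f" using assms(3) continuous_on_subset by auto
  then show ?case
    using continuous_on_compose[OF linear_continuous_on[OF assms(1)]] by (simp add: o_def)
next
  case (Suc k)
  note f = Ck_on_SucD[OF Suc.prems]
  have "((\<lambda>x. f (L x)) has_derivative (\<lambda>v. frechet_derivative f (at (L x)) (L v))) (at x)"
    if "x \<in> T" for x
    using has_derivative_compose[OF bounded_linear_imp_has_derivative[OF assms(1)] f(1)] that assms(3)
    by blast
  then show ?case
    by (rule Ck_on_SucI[OF assms(2)]) (auto intro!: Suc.IH f)
qed

lemma Ck_on_id: "open S \<Longrightarrow> Ck_on k S (\<lambda>x. x)"
proof (cases k)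
  case (Suc l)
  assume "open S"
  then show ?thesis
    unfolding Suc by (rule Ck_on_SucI[OF _ has_derivative_ident]) (rule Ck_on_const)
qed auto

lemma smooth_on_const: "smooth_on S (\<lambda>x. c)"
  by (simp add: smooth_on_def Ck_on_const)

lemma smooth_on_add:
  "open S \<Longrightarrow> smooth_on S f \<Longrightarrow> smooth_on S g \<Longrightarrow> smooth_on S (\<lambda>x. f x + g x)"
  by (simp add: smooth_on_def Ck_on_add)

lemma smooth_on_bounded_bilinear:
  "bounded_bilinear p \<Longrightarrow> open S \<Longrightarrow> smooth_on S f \<Longrightarrow> smooth_on S g \<Longrightarrow>
    smooth_on S (\<lambda>x. p (f x) (g x))"
  by (simp add: smooth_on_def Ck_on_bounded_bilinear)

lemma smooth_on_bounded_linear_comp: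
  "bounded_linear L \<Longrightarrow> open S \<Longrightarrow> smooth_on S f \<Longrightarrow> smooth_on S (\<lambda>x. L (f x))"
  by (simp add: smooth_on_def Ck_on_bounded_linear_comp)

lemma smooth_on_comp_bounded_linear:
  "bounded_linear L \<Longrightarrow> open T \<Longrightarrow> L ` T \<subseteq> S \<Longrightarrow> smooth_on S f \<Longrightarrow> smooth_on T (\<lambda>x. f (L x))"
  by (simp add: smooth_on_def Ck_on_comp_bounded_linear[of L T S])

lemma smooth_on_bounded_linear: "open S \<Longrightarrow> bounded_linear L \<Longrightarrow> smooth_on S L"
  using smooth_on_bounded_linear_comp[of L S "\<lambda>x. x"] by (simp add: smooth_on_def Ck_on_id)

lemma smooth_on_uminus: "open S \<Longrightarrow> smooth_on S f \<Longrightarrow> smooth_on S (\<lambda>x. - f x)"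
  by (rule smooth_on_bounded_linear_comp[OF bounded_linear_minus[OF bounded_linear_ident]])

lemma smooth_on_diff:
  "open S \<Longrightarrow> smooth_on S f \<Longrightarrow> smooth_on S g \<Longrightarrow> smooth_on S (\<lambda>x. f x - g x)"
  using smooth_on_add[of S f "\<lambda>x. - g x"] smooth_on_uminus[of S g] by simp

lemma smooth_on_scaleR:
  "open S \<Longrightarrow> smooth_on S f \<Longrightarrow> smooth_on S g \<Longrightarrow> smooth_on S (\<lambda>x. f x *\<^sub>R g x)"
  by (rule smooth_on_bounded_bilinear[OF bounded_bilinear_scaleR])

lemma smooth_on_inner_const: "open S \<Longrightarrow> smooth_on S f \<Longrightarrow> smooth_on S (\<lambda>x. f x \<bullet> b)"
  by (rule smooth_on_bounded_linear_comp[OF bounded_linear_inner_left])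

lemma smooth_on_sum:
  "open S \<Longrightarrow> (\<And>b. b \<in> B \<Longrightarrow> smooth_on S (f b)) \<Longrightarrow> smooth_on S (\<lambda>x. \<Sum>b\<in>B. f b x)"
  by (induction B rule: infinite_finite_induct) (simp_all add: smooth_on_add smooth_on_const)

lemma smooth_on_Pair:
  assumes "open S" "smooth_on S f" "smooth_on S g"
  shows "smooth_on S (\<lambda>x. (f x, g x))"
proof -
  have "smooth_on S (\<lambda>x. (f x, 0) + (0, g x))"
    using assms by (intro smooth_on_add smooth_on_bounded_linear_comp[of "\<lambda>a. (a, 0)"]
        smooth_on_bounded_linear_comp[of "\<lambda>a. (0, a)"])
      (auto intro!: bounded_linear_Pair bounded_linear_ident bounded_linear_zero)
  then show ?thesis by simp
qed

section \<open>Families of linear maps evaluated on a moving vector\<close>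

lemma linear_eq_sum_Basis:
  fixes L :: "'a::euclidean_space \<Rightarrow> 'b::real_vector"
  assumes "linear L"
  shows "L v = (\<Sum>b\<in>Basis. (v \<bullet> b) *\<^sub>R L b)"
proof -
  have "L v = L (\<Sum>b\<in>Basis. (v \<bullet> b) *\<^sub>R b)" by (simp add: euclidean_representation)
  then show ?thesis by (simp add: linear_sum[OF assms] linear_scale[OF assms])
qed

text \<open>A basis expansion turns \<open>L x (g x)\<close> into a finite sum of products, so
  smoothness on each fixed vector is enough and no norm on a space of linear maps enters.\<close>

lemma smooth_on_apply_linear:
  fixes L :: "'a::real_normed_vector \<Rightarrow> 'b::euclidean_space \<Rightarrow> 'c::real_normed_vector"
  assumes "open S" "\<And>x. x \<in> S \<Longrightarrow> linear (L x)" "\<And>v. smooth_on S (\<lambda>x. L x v)" "smooth_on S g"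
  shows "smooth_on S (\<lambda>x. L x (g x))"
proof -
  have "smooth_on S (\<lambda>x. \<Sum>b\<in>Basis. (g x \<bullet> b) *\<^sub>R L x b)"
    by (intro smooth_on_sum smooth_on_scaleR smooth_on_inner_const assms)
  moreover have "L x (g x) = (\<Sum>b\<in>Basis. (g x \<bullet> b) *\<^sub>R L x b)" if "x \<in> S" for x
    by (rule linear_eq_sum_Basis) (rule assms(2)[OF that])
  ultimately show ?thesis using smooth_on_cong[OF assms(1), of "\<lambda>x. L x (g x)"] by simp
qed

lemma linear_frechet_derivative_smooth_on:
  "smooth_on S f \<Longrightarrow> x \<in> S \<Longrightarrow> linear (frechet_derivative f (at x))"
  by (simp add: linear_frechet_derivative smooth_on_imp_differentiable)

lemma smooth_on_derivative_along:
  fixes f :: "'a::euclidean_space \<Rightarrow> 'b::real_normed_vector"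
  assumes "open S" "smooth_on S f" "smooth_on S g"
  shows "smooth_on S (\<lambda>x. frechet_derivative f (at x) (g x))"
  by (rule smooth_on_apply_linear[OF assms(1) linear_frechet_derivative_smooth_on[OF assms(2)]
        smooth_on_derivative[OF assms(2)] assms(3)])

text \<open>Product rule for the evaluation pairing, again through the basis expansion; in the first
  summand the vector is frozen at \<open>g x\<close>.\<close>

lemma linear_family_derivative:
  fixes L :: "'a::real_normed_vector \<Rightarrow> 'b::euclidean_space \<Rightarrow> 'c::real_normed_vector"
  assumes "open S" "x \<in> S" "\<And>x. x \<in> S \<Longrightarrow> linear (L x)"
    and L: "\<And>v. (\<lambda>x. L x v) differentiable (at x)" and g: "(g has_derivative g') (at x)"
  shows "((\<lambda>x. L x (g x)) has_derivative
    (\<lambda>v. frechet_derivative (\<lambda>y. L y (g x)) (at x) v + L x (g' v))) (at x)"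
proof -
  have d: "((\<lambda>x. L x v) has_derivative frechet_derivative (\<lambda>x. L x v) (at x)) (at x)" for v
    using L frechet_derivative_works by blast
  have *: "((\<lambda>y. L y w) has_derivative
      (\<lambda>v. \<Sum>b\<in>Basis. (w \<bullet> b) *\<^sub>R frechet_derivative (\<lambda>y. L y b) (at x) v)) (at x)" for w
  proof (rule has_derivative_transform_within_open[OF _ assms(1,2)])
    show "((\<lambda>y. \<Sum>b\<in>Basis. (w \<bullet> b) *\<^sub>R L y b) has_derivative
      (\<lambda>v. \<Sum>b\<in>Basis. (w \<bullet> b) *\<^sub>R frechet_derivative (\<lambda>y. L y b) (at x) v)) (at x)"
      by (intro has_derivative_sum has_derivative_scaleR_right d)
    show "(\<Sum>b\<in>Basis. (w \<bullet> b) *\<^sub>R L y b) = L y w" if "y \<in> S" for y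
      using linear_eq_sum_Basis[OF assms(3)[OF that]] by metis
  qed
  have eq: "frechet_derivative (\<lambda>y. L y w) (at x) =
      (\<lambda>v. \<Sum>b\<in>Basis. (w \<bullet> b) *\<^sub>R frechet_derivative (\<lambda>y. L y b) (at x) v)" for w
    by (rule frechet_derivative_at[OF *, symmetric])
  have "((\<lambda>y. \<Sum>b\<in>Basis. (g y \<bullet> b) *\<^sub>R L y b) has_derivative (\<lambda>v. \<Sum>b\<in>Basis.
     (g x \<bullet> b) *\<^sub>R frechet_derivative (\<lambda>y. L y b) (at x) v + (g' v \<bullet> b) *\<^sub>R L x b)) (at x)"
    by (intro has_derivative_sum has_derivative_scaleR d g has_derivative_inner_left)
  also have "(\<lambda>v. \<Sum>b\<in>Basis.
     (g x \<bullet> b) *\<^sub>R frechet_derivative (\<lambda>y. L y b) (at x) v + (g' v \<bullet> b) *\<^sub>R L x b) =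
     (\<lambda>v. frechet_derivative (\<lambda>y. L y (g x)) (at x) v + L x (g' v))"
    unfolding eq[of "g x"] linear_eq_sum_Basis[OF assms(3)[OF assms(2)], of "g' v" for v]
    by (rule ext) (rule sum.distrib)
  finally show ?thesis
    by (rule has_derivative_transform_within_open[OF _ assms(1,2)])
      (rule linear_eq_sum_Basis[OF assms(3), symmetric])
qed

text \<open>Separates the second derivative of \<open>f\<close>, with the direction frozen at
  \<open>g x\<close>, from the term in which \<open>g\<close> is differentiated. The former is
  symmetric, which is what makes brackets behave.\<close>

lemma derivative_of_directional_derivative:
  fixes f :: "'a::euclidean_space \<Rightarrow> 'b::real_normed_vector"
  assumes "open S" "x \<in> S" "smooth_on S f" "smooth_on S g"
  shows "frechet_derivative (\<lambda>x. frechet_derivative f (at x) (g x)) (at x) v =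
    frechet_derivative (\<lambda>y. frechet_derivative f (at y) (g x)) (at x) v +
    frechet_derivative f (at x) (frechet_derivative g (at x) v)"
  using frechet_derivative_at[OF linear_family_derivative[OF assms(1,2),
        of "\<lambda>x. frechet_derivative f (at x)" g "frechet_derivative g (at x)"]]
    linear_frechet_derivative_smooth_on[OF assms(3)] smooth_on_imp_has_derivative[OF assms(4,2)]
    smooth_on_imp_differentiable[OF smooth_on_derivative[OF assms(3)] assms(2)]
  by (simp add: fun_eq_iff)

section \<open>Symmetry of second derivatives\<close>

lemma second_difference_mean_value:
  fixes f :: "'a::euclidean_space \<Rightarrow> real"
  assumes "smooth_on S f" "h > 0"
    and S: "\<And>s t. 0 \<le> s \<Longrightarrow> s \<le> h \<Longrightarrow> 0 \<le> t \<Longrightarrow> t \<le> h \<Longrightarrow> x + s *\<^sub>R v + t *\<^sub>R w \<in> S"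
  shows "\<exists>s t. 0 < s \<and> s < h \<and> 0 < t \<and> t < h \<and>
    f (x + h *\<^sub>R v + h *\<^sub>R w) - f (x + h *\<^sub>R v) - f (x + h *\<^sub>R w) + f x =
    h * h * frechet_derivative (\<lambda>y. frechet_derivative f (at y) v) (at (x + s *\<^sub>R v + t *\<^sub>R w)) w"
proof -
  have line: "((\<lambda>s. F (c + s *\<^sub>R a)) has_real_derivative
      frechet_derivative F (at (c + s *\<^sub>R a)) a) (at s)"
    if "smooth_on S F" "c + s *\<^sub>R a \<in> S" for F :: "'a \<Rightarrow> real" and a c s
  proof -
    have "((\<lambda>s. c + s *\<^sub>R a) has_derivative (\<lambda>r. r *\<^sub>R a)) (at s)"
      by (auto intro!: derivative_eq_intros)
    from has_derivative_compose[OF this smooth_on_imp_has_derivative[OF that]]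
    show ?thesis
      by (simp add: has_field_derivative_def mult_commute_abs mult.commute[of _ "frechet_derivative F _ a"]
          linear_scale[OF linear_frechet_derivative_smooth_on[OF that]])
  qed
  \<comment> \<open>The increment of \<open>p\<close> over [0, h] is the mixed second difference.
    The mean value theorem for \<open>p\<close> produces the derivative along \<open>v\<close>; a
    second application then differentiates along \<open>w\<close>.\<close>
  define p where "p s = f ((x + h *\<^sub>R w) + s *\<^sub>R v) - f (x + s *\<^sub>R v)" for s
  have "\<exists>s. 0 < s \<and> s < h \<and> p h - p 0 = (h - 0) *
     (frechet_derivative f (at ((x + h *\<^sub>R w) + s *\<^sub>R v)) v - frechet_derivative f (at (x + s *\<^sub>R v)) v)"
    unfolding p_def
  proof (rule MVT2[OF assms(2)], intro DERIV_diff line assms)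
    fix s assume "0 \<le> s" "s \<le> h"
    then show "x + h *\<^sub>R w + s *\<^sub>R v \<in> S" "x + s *\<^sub>R v \<in> S"
      using S[of s h] S[of s 0] assms(2) by (auto simp: algebra_simps)
  qed
  then obtain s where s: "0 < s" "s < h" "p h - p 0 = h *
     (frechet_derivative f (at ((x + s *\<^sub>R v) + h *\<^sub>R w)) v - frechet_derivative f (at ((x + s *\<^sub>R v) + 0 *\<^sub>R w)) v)"
    by (auto simp: algebra_simps)
  let ?f = "\<lambda>y. frechet_derivative f (at y) v"
  have "\<exists>t. 0 < t \<and> t < h \<and> ?f ((x + s *\<^sub>R v) + h *\<^sub>R w) - ?f ((x + s *\<^sub>R v) + 0 *\<^sub>R w) =
    (h - 0) * frechet_derivative ?f (at ((x + s *\<^sub>R v) + t *\<^sub>R w)) w"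
    using s S by (intro MVT2[OF assms(2)] line smooth_on_derivative assms) auto
  then obtain t where t: "0 < t" "t < h" "?f ((x + s *\<^sub>R v) + h *\<^sub>R w) - ?f ((x + s *\<^sub>R v) + 0 *\<^sub>R w) =
    h * frechet_derivative ?f (at ((x + s *\<^sub>R v) + t *\<^sub>R w)) w" by auto
  have "p h - p 0 = f (x + h *\<^sub>R v + h *\<^sub>R w) - f (x + h *\<^sub>R v) - f (x + h *\<^sub>R w) + f x"
    by (simp add: p_def algebra_simps)
  then show ?thesis using s t by (intro exI[of _ s] exI[of _ t]) simp
qed

lemma frechet_derivative_bounded_linear_comp:
  assumes "bounded_linear L" "f differentiable (at x)"
  shows "frechet_derivative (\<lambda>x. L (f x)) (at x) = (\<lambda>v. L (frechet_derivative f (at x) v))"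
  using bounded_linear.has_derivative[OF assms(1)] assms(2) frechet_derivative_works frechet_derivative_at
  by metis

text \<open>The mixed second difference is symmetric in \<open>v\<close> and \<open>w\<close>, and
  it equals h^2 times either mixed derivative, taken at some point of the parallelogram with sides h
  v and h w. As h tends to 0 these points tend to \<open>x\<close>, and continuity finishes.\<close>

lemma symmetric_second_derivative_real:
  fixes f :: "'a::euclidean_space \<Rightarrow> real"
  assumes "open S" "x \<in> S" "smooth_on S f"
  shows "frechet_derivative (\<lambda>y. frechet_derivative f (at y) v) (at x) w =
    frechet_derivative (\<lambda>y. frechet_derivative f (at y) w) (at x) v"
proof -
  define F where "F v w y = frechet_derivative (\<lambda>y. frechet_derivative f (at y) v) (at y) w" for v w y
  have cont: "isCont (F v w) x" for v w
    using smooth_on_imp_continuous_on[OF smooth_on_derivative[OF smooth_on_derivative[OF assms(3), of v], of w]]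
      assms(1,2) continuous_on_eq_continuous_at unfolding F_def by blast
  obtain e where e: "e > 0" "ball x e \<subseteq> S"
    using assms(1,2) open_contains_ball by blast
  \<comment> \<open>For h < \<open>d\<close> the parallelogram stays in the ball of radius
    \<open>e\<close>. The summand 1 keeps the denominator positive when \<open>v\<close> and
    \<open>w\<close> are both 0.\<close>
  define d where "d = e / (norm v + norm w + 1)"
  have "d > 0" using e by (simp add: d_def add_nonneg_pos)
  have close: "dist (x + s *\<^sub>R v + t *\<^sub>R w) x \<le> h * (norm v + norm w)"
    if "0 \<le> s" "s \<le> h" "0 \<le> t" "t \<le> h" for s t h
  proof -
    have "dist (x + s *\<^sub>R v + t *\<^sub>R w) x \<le> norm (s *\<^sub>R v) + norm (t *\<^sub>R w)"
      using norm_triangle_ineq[of "s *\<^sub>R v" "t *\<^sub>R w"] by (simp add: dist_norm add.assoc)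
    also have "\<dots> \<le> h * norm v + h * norm w" using that by (intro add_mono) (auto intro: mult_right_mono)
    finally show ?thesis by (simp add: algebra_simps)
  qed
  have inS: "x + s *\<^sub>R v + t *\<^sub>R w \<in> S" if "0 \<le> s" "s \<le> h" "0 \<le> t" "t \<le> h" "h < d" for s t h
  proof -
    have "h * (norm v + norm w) \<le> d * (norm v + norm w)" using that by (intro mult_right_mono) auto
    also have "\<dots> < d * (norm v + norm w + 1)" using \<open>d > 0\<close> by (simp add: algebra_simps)
    also have "\<dots> = e"
      using add_nonneg_pos[of "norm v + norm w" 1] by (simp add: d_def)
    finally show ?thesis using close[OF that(1-4)] e(2) by (auto simp: dist_commute subset_iff)
  qed
  \<comment> \<open>With \<open>n + 2\<close> the bound \<open>h n < d\<close> is strict at n = 0 as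
    well.\<close>
  define h where "h n = d / real (n + 2)" for n
  have h: "0 < h n" "h n < d" for n using \<open>d > 0\<close> by (auto simp: h_def field_simps intro!: add_pos_nonneg)
  have "\<exists>s t s' t'. 0 < s \<and> s < h n \<and> 0 < t \<and> t < h n \<and> 0 < s' \<and> s' < h n \<and> 0 < t' \<and> t' < h n \<and>
    F v w (x + s *\<^sub>R v + t *\<^sub>R w) = F w v (x + t' *\<^sub>R v + s' *\<^sub>R w)" for n
  proof -
    have inS1: "x + s *\<^sub>R v + t *\<^sub>R w \<in> S" if "0 \<le> s" "s \<le> h n" "0 \<le> t" "t \<le> h n" for s t
      by (rule inS[OF that h(2)])
    have inS2: "x + s *\<^sub>R w + t *\<^sub>R v \<in> S" if "0 \<le> s" "s \<le> h n" "0 \<le> t" "t \<le> h n" for s t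
      using inS1[OF that(3,4,1,2)] by (simp add: algebra_simps)
    obtain s t where st: "0 < s" "s < h n" "0 < t" "t < h n"
       "f (x + h n *\<^sub>R v + h n *\<^sub>R w) - f (x + h n *\<^sub>R v) - f (x + h n *\<^sub>R w) + f x =
       h n * h n * F v w (x + s *\<^sub>R v + t *\<^sub>R w)"
      using second_difference_mean_value[OF assms(3) h(1)[of n], of x v w, folded F_def,
          OF inS1] by blast
    obtain s' t' where st': "0 < s'" "s' < h n" "0 < t'" "t' < h n"
       "f (x + h n *\<^sub>R w + h n *\<^sub>R v) - f (x + h n *\<^sub>R w) - f (x + h n *\<^sub>R v) + f x =
       h n * h n * F w v (x + s' *\<^sub>R w + t' *\<^sub>R v)"
      using second_difference_mean_value[OF assms(3) h(1)[of n], of x w v, folded F_def, OF inS2] by blast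
    have "h n * h n * F v w (x + s *\<^sub>R v + t *\<^sub>R w) = h n * h n * F w v (x + s' *\<^sub>R w + t' *\<^sub>R v)"
      using st(5) st'(5) by (simp add: algebra_simps)
    then have "F v w (x + s *\<^sub>R v + t *\<^sub>R w) = F w v (x + t' *\<^sub>R v + s' *\<^sub>R w)"
      using h(1)[of n] by (simp add: add.assoc add.commute[of "s' *\<^sub>R w"])
    then show ?thesis using st st' by blast
  qed
  then obtain s t s' t' where st: "\<And>n. 0 < s n \<and> s n < h n \<and> 0 < t n \<and> t n < h n \<and>
     0 < s' n \<and> s' n < h n \<and> 0 < t' n \<and> t' n < h n \<and>
     F v w (x + s n *\<^sub>R v + t n *\<^sub>R w) = F w v (x + t' n *\<^sub>R v + s' n *\<^sub>R w)" by metis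
  have h0: "h \<longlonglongrightarrow> 0" unfolding h_def
    by (rule LIMSEQ_ignore_initial_segment[OF lim_const_over_n, of d 2])
  have lim: "(\<lambda>n. x + a n *\<^sub>R v + b n *\<^sub>R w) \<longlonglongrightarrow> x"
    if "\<And>n. 0 < a n \<and> a n < h n \<and> 0 < b n \<and> b n < h n" for a b
  proof -
    have "a \<longlonglongrightarrow> 0" "b \<longlonglongrightarrow> 0"
      using that by (auto intro!: tendsto_sandwich[OF _ _ tendsto_const h0] always_eventually less_imp_le)
    then have "(\<lambda>n. x + a n *\<^sub>R v + b n *\<^sub>R w) \<longlonglongrightarrow> x + 0 *\<^sub>R v + 0 *\<^sub>R w"
      by (intro tendsto_intros)
    then show ?thesis by simp
  qed
  have "(\<lambda>n. F v w (x + s n *\<^sub>R v + t n *\<^sub>R w)) \<longlonglongrightarrow> F v w x"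
    using cont st by (intro isCont_tendsto_compose[OF cont] lim) auto
  moreover have "(\<lambda>n. F w v (x + t' n *\<^sub>R v + s' n *\<^sub>R w)) \<longlonglongrightarrow> F w v x"
    using cont st by (intro isCont_tendsto_compose[OF cont] lim) auto
  ultimately show ?thesis using st LIMSEQ_unique unfolding F_def by simp
qed

text \<open>The mean value theorem needs real values, so the components with respect to the basis
  are treated separately.\<close>

lemma symmetric_second_derivative:
  fixes f :: "'a::euclidean_space \<Rightarrow> 'b::euclidean_space"
  assumes "open S" "x \<in> S" "smooth_on S f"
  shows "frechet_derivative (\<lambda>y. frechet_derivative f (at y) v) (at x) w =
    frechet_derivative (\<lambda>y. frechet_derivative f (at y) w) (at x) v"
proof (rule euclidean_eqI)
  fix b :: 'b
  have f1: "frechet_derivative (\<lambda>y. f y \<bullet> b) (at y) v = frechet_derivative f (at y) v \<bullet> b"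
    if "y \<in> S" for y v
    using frechet_derivative_bounded_linear_comp[OF bounded_linear_inner_left
        smooth_on_imp_differentiable[OF assms(3) that]] by metis
  have f2: "frechet_derivative (\<lambda>y. frechet_derivative (\<lambda>y. f y \<bullet> b) (at y) v) (at x) w =
     frechet_derivative (\<lambda>y. frechet_derivative f (at y) v) (at x) w \<bullet> b" for v w
  proof -
    have "frechet_derivative (\<lambda>y. frechet_derivative (\<lambda>y. f y \<bullet> b) (at y) v) (at x) =
       frechet_derivative (\<lambda>y. frechet_derivative f (at y) v \<bullet> b) (at x)"
      using assms by (intro frechet_derivative_cong_open[of S]) (auto simp: f1)
    then show ?thesis
      using frechet_derivative_bounded_linear_comp[OF bounded_linear_inner_left
        smooth_on_imp_differentiable[OF smooth_on_derivative[OF assms(3)] assms(2)]] by metis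
  qed
  show "frechet_derivative (\<lambda>y. frechet_derivative f (at y) v) (at x) w \<bullet> b =
    frechet_derivative (\<lambda>y. frechet_derivative f (at y) w) (at x) v \<bullet> b"
    using symmetric_second_derivative_real[OF assms(1,2) smooth_on_inner_const[OF assms(1,3), of b], of v w]
    unfolding f2 .
qed

section \<open>Inverses of smooth families of linear maps\<close>

lemma Ck_on_sum:
  "open S \<Longrightarrow> (\<And>b. b \<in> B \<Longrightarrow> Ck_on k S (f b)) \<Longrightarrow> Ck_on k S (\<lambda>x. \<Sum>b\<in>B. f b x)"
  by (induction B rule: infinite_finite_induct) (simp_all add: Ck_on_add Ck_on_const)

text \<open>At a zero of \<phi> the product is differentiable although \<psi> is merely continuous:
  the term of the product rule that would contain a derivative of \<psi> carries the factor
  \<phi>(x) = 0.\<close>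

lemma has_derivative_scaleR_at_zero:
  fixes \<psi> :: "'a::real_normed_vector \<Rightarrow> 'b::real_normed_vector"
  assumes "(\<phi> has_derivative \<phi>') (at x)" "\<phi> x = 0" "isCont \<psi> x"
  shows "((\<lambda>y. \<phi> y *\<^sub>R \<psi> y) has_derivative (\<lambda>v. \<phi>' v *\<^sub>R \<psi> x)) (at x)"
proof -
  have bl: "bounded_linear \<phi>'" using assms(1) by (rule has_derivative_bounded_linear)
  then obtain C where C: "\<And>v. norm (\<phi>' v) \<le> norm v * C" using bounded_linear.bounded by metis
  let ?q = "\<lambda>y. (\<phi> y - \<phi>' (y - x)) /\<^sub>R norm (y - x)"
  have \<psi>: "(\<psi> \<longlongrightarrow> \<psi> x) (at x)" using assms(3) isContD by blast
  have "(?q \<longlongrightarrow> 0) (at x)" using assms(1,2) by (simp add: has_derivative_at_within)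
  from tendsto_scaleR[OF this \<psi>] have 1: "((\<lambda>y. ?q y *\<^sub>R \<psi> y) \<longlongrightarrow> 0) (at x)" by simp
  have 2: "((\<lambda>y. (\<phi>' (y - x) / norm (y - x)) *\<^sub>R (\<psi> y - \<psi> x)) \<longlongrightarrow> 0) (at x)"
  proof (rule Lim_null_comparison)
    have "norm ((\<phi>' (y - x) / norm (y - x)) *\<^sub>R (\<psi> y - \<psi> x)) \<le> C * norm (\<psi> y - \<psi> x)"
      if "y \<noteq> x" for y
    proof -
      have "norm (\<phi>' (y - x)) / norm (y - x) \<le> C"
        using C[of "y - x"] that by (simp add: field_simps)
      from mult_right_mono[OF this, of "norm (\<psi> y - \<psi> x)"]
      show "norm ((\<phi>' (y - x) / norm (y - x)) *\<^sub>R (\<psi> y - \<psi> x)) \<le> C * norm (\<psi> y - \<psi> x)"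
        by simp
    qed
    then show "\<forall>\<^sub>F y in at x. norm ((\<phi>' (y - x) / norm (y - x)) *\<^sub>R (\<psi> y - \<psi> x))
        \<le> C * norm (\<psi> y - \<psi> x)"
      by (simp add: eventually_at_filter)
    show "((\<lambda>y. C * norm (\<psi> y - \<psi> x)) \<longlongrightarrow> 0) (at x)"
      using tendsto_mult[OF tendsto_const tendsto_norm_zero[OF LIM_zero[OF \<psi>]], of C] by simp
  qed
  \<comment> \<open>Since \<phi>(x) = 0, the remainder is (\<phi>(y) - \<phi>'(y - x)) \<psi>(y) +
    \<phi>'(y - x) (\<psi>(y) - \<psi>(x)); divided by the norm of y - x, the two parts are the
    limits 1 and 2.\<close>
  have "(\<lambda>y. ?q y *\<^sub>R \<psi> y + (\<phi>' (y - x) / norm (y - x)) *\<^sub>R (\<psi> y - \<psi> x)) =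
      (\<lambda>y. (\<phi> y *\<^sub>R \<psi> y - \<phi> x *\<^sub>R \<psi> x - \<phi>' (y - x) *\<^sub>R \<psi> x) /\<^sub>R norm (y - x))"
    using assms(2) by (simp add: fun_eq_iff algebra_simps divide_inverse)
  then have "((\<lambda>y. (\<phi> y *\<^sub>R \<psi> y - \<phi> x *\<^sub>R \<psi> x - \<phi>' (y - x) *\<^sub>R \<psi> x) /\<^sub>R norm (y - x)) \<longlongrightarrow> 0) (at x)"
    using tendsto_add[OF 1 2] by (simp only: add_0_left)
  with bounded_linear_compose[OF bounded_linear_scaleR_left bl] show ?thesis
    unfolding has_derivative_at_within by blast
qed

text \<open>If |L(x)v| is at least c|v|, then |L(y)v| is at least (c/2)|v| once L(y) and L(x) differ
  by less than c/2, summed over the basis. This bounds the difference of the two preimages of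
  \<open>w\<close>, because L(y) maps it to (L(x) - L(y))z with z the preimage under L(x).\<close>

lemma continuous_inv_linear_family:
  fixes L :: "'a::real_normed_vector \<Rightarrow> 'b::euclidean_space \<Rightarrow> 'b"
  assumes "open S" "x \<in> S" and lin: "\<And>y. y \<in> S \<Longrightarrow> linear (L y)"
    and inj: "\<And>y. y \<in> S \<Longrightarrow> inj (L y)" and cont: "\<And>v. continuous_on S (\<lambda>y. L y v)"
  shows "isCont (\<lambda>y. inv (L y) w) x"
proof -
  have cont': "((\<lambda>y. L y v) \<longlongrightarrow> L x v) (at x)" for v
    using cont assms(1,2) continuous_on_eq_continuous_at isContD by blast
  have surj: "L y (inv (L y) v) = v" if "y \<in> S" for y v
    using linear_inj_imp_surj[OF lin[OF that] inj[OF that]] by (rule surj_f_inv_f)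
  obtain c where c: "c > 0" "\<And>v. c * norm v \<le> norm (L x v)"
    using linear_inj_bounded_below_pos[OF lin[OF assms(2)] inj[OF assms(2)]] by blast
  have "((\<lambda>y. \<Sum>b\<in>Basis. norm (L y b - L x b)) \<longlongrightarrow> 0) (at x)"
    by (rule tendsto_null_sum, rule tendsto_norm_zero, rule LIM_zero, rule cont')
  then have "\<forall>\<^sub>F y in at x. (\<Sum>b\<in>Basis. norm (L y b - L x b)) < c / 2"
    using c(1) by (intro order_tendstoD(2)) auto
  moreover have "\<forall>\<^sub>F y in at x. y \<in> S" using assms(1,2) by (rule eventually_at_in_open')
  ultimately have ev: "\<forall>\<^sub>F y in at x. norm (inv (L y) w - inv (L x) w) \<le>
      (2 / c) * norm (L x (inv (L x) w) - L y (inv (L x) w))"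
  proof eventually_elim
    case (elim y)
    have lower: "c / 2 * norm v \<le> norm (L y v)" for v
    proof -
      have "L y v - L x v = (\<Sum>b\<in>Basis. (v \<bullet> b) *\<^sub>R (L y b - L x b))"
        unfolding linear_eq_sum_Basis[OF lin[OF elim(2)], of v] linear_eq_sum_Basis[OF lin[OF assms(2)], of v]
        by (simp add: sum_subtractf algebra_simps)
      also have "norm \<dots> \<le> (\<Sum>b\<in>Basis. norm v * norm (L y b - L x b))"
        by (intro sum_norm_le) (simp add: Basis_le_norm mult_right_mono)
      also have "\<dots> \<le> c / 2 * norm v"
        using mult_right_mono[OF less_imp_le[OF elim(1)], of "norm v"]
        by (simp add: sum_distrib_left[symmetric] mult.commute)
      finally show ?thesis using c(2)[of v] norm_triangle_ineq2[of "L x v" "L y v"]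
        by (simp add: norm_minus_commute)
    qed
    have eq: "L y (inv (L y) w - inv (L x) w) = L x (inv (L x) w) - L y (inv (L x) w)"
      by (simp add: linear_diff[OF lin[OF elim(2)]] surj elim assms(2))
    show ?case using lower[of "inv (L y) w - inv (L x) w", unfolded eq] c(1) by (simp add: field_simps)
  qed
  have "((\<lambda>y. (2 / c) * norm (L x (inv (L x) w) - L y (inv (L x) w))) \<longlongrightarrow>
      (2 / c) * norm (L x (inv (L x) w) - L x (inv (L x) w))) (at x)"
    by (intro tendsto_intros cont')
  then have "((\<lambda>y. inv (L y) w - inv (L x) w) \<longlongrightarrow> 0) (at x)"
    by (intro Lim_null_comparison[OF ev]) simp
  then show ?thesis by (simp add: isCont_def LIM_zero_iff)
qed

text \<open>With \<open>z = L(x)\<^sup>-\<^sup>1w\<close> one has \<open>L(y)\<^sup>-\<^sup>1w = z + L(y)\<^sup>-\<^sup>1(w - L(y)z)\<close>, and \<open>w - L(y)z\<close> vanishes at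
  \<open>y = x\<close>; so continuity of the inverse already gives its derivative.\<close>

lemma has_derivative_inv_linear_family:
  fixes L :: "'a::real_normed_vector \<Rightarrow> 'b::euclidean_space \<Rightarrow> 'b"
  assumes "open S" "x \<in> S" and lin: "\<And>y. y \<in> S \<Longrightarrow> linear (L y)"
    and inj: "\<And>y. y \<in> S \<Longrightarrow> inj (L y)" and cont: "\<And>v. continuous_on S (\<lambda>y. L y v)"
    and diff: "\<And>v. ((\<lambda>y. L y v) has_derivative L' v) (at x)"
  shows "((\<lambda>y. inv (L y) w) has_derivative (\<lambda>v. - (\<Sum>b\<in>Basis.
    (\<Sum>c\<in>Basis. (inv (L x) w \<bullet> c) *\<^sub>R (L' c v \<bullet> b)) *\<^sub>R inv (L x) b))) (at x)"
proof -
  define z where "z = inv (L x) w"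
  have surj: "L y (inv (L y) v) = v" if "y \<in> S" for y v
    using linear_inj_imp_surj[OF lin[OF that] inj[OF that]] by (rule surj_f_inv_f)
  have linv: "linear (inv (L y))" if "y \<in> S" for y
    using inj_linear_imp_inv_linear[OF lin inj] that by blast
  have Lz: "L y z = (\<Sum>c\<in>Basis. (z \<bullet> c) *\<^sub>R L y c)" if "y \<in> S" for y
    by (rule linear_eq_sum_Basis[OF lin[OF that]])
  \<comment> \<open>Expanding z makes the resulting derivative a sum of products of components of
    \<open>inv (L x) w\<close>, the vectors \<open>inv (L x) b\<close>, and derivatives of
    \<open>L y c\<close> for fixed \<open>c\<close>; only in this form can it be differentiated
    further in \<open>x\<close>.\<close>
  define E where "E y = w - (\<Sum>c\<in>Basis. (z \<bullet> c) *\<^sub>R L y c)" for y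
  have E0: "E x = 0" unfolding E_def using Lz[OF assms(2)] surj[OF assms(2)] by (simp add: z_def)
  have dE: "(E has_derivative (\<lambda>v. - (\<Sum>c\<in>Basis. (z \<bullet> c) *\<^sub>R L' c v))) (at x)"
    unfolding E_def by (rule derivative_eq_intros diff refl)+ simp
  have "((\<lambda>y. z + (\<Sum>b\<in>Basis. (E y \<bullet> b) *\<^sub>R inv (L y) b)) has_derivative (\<lambda>v. 0 + (\<Sum>b\<in>Basis.
    (- (\<Sum>c\<in>Basis. (z \<bullet> c) *\<^sub>R L' c v) \<bullet> b) *\<^sub>R inv (L x) b))) (at x)"
    by (intro has_derivative_add has_derivative_const has_derivative_sum
        has_derivative_scaleR_at_zero has_derivative_inner_left dE
        continuous_inv_linear_family[OF assms(1-5)]) (auto simp: E0)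
  moreover have "z + (\<Sum>b\<in>Basis. (E y \<bullet> b) *\<^sub>R inv (L y) b) = inv (L y) w" if "y \<in> S" for y
  proof -
    have "inv (L y) (L y z) = z" using inj[OF that] by simp
    then show ?thesis
      by (simp add: linear_eq_sum_Basis[OF linv[OF that], symmetric] E_def Lz[OF that, symmetric]
          linear_diff[OF linv[OF that]])
  qed
  ultimately have "((\<lambda>y. inv (L y) w) has_derivative (\<lambda>v. 0 + (\<Sum>b\<in>Basis.
    (- (\<Sum>c\<in>Basis. (z \<bullet> c) *\<^sub>R L' c v) \<bullet> b) *\<^sub>R inv (L x) b))) (at x)"
    by (rule has_derivative_transform_within_open[OF _ assms(1,2)])
  then show ?thesis by (simp add: z_def inner_sum_left sum_negf)
qed

text \<open>Bootstrapping: the derivative of the inverse is a polynomial expression in the inverse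
  itself and derivatives of \<open>L\<close>, so class k yields class k + 1. The vector
  \<open>w\<close> is generalised because the inverse is also applied to basis vectors
  there.\<close>

lemma smooth_on_inv_linear_family:
  fixes L :: "'a::real_normed_vector \<Rightarrow> 'b::euclidean_space \<Rightarrow> 'b"
  assumes S: "open S" and lin: "\<And>y. y \<in> S \<Longrightarrow> linear (L y)"
    and inj: "\<And>y. y \<in> S \<Longrightarrow> inj (L y)" and smooth: "\<And>v. smooth_on S (\<lambda>y. L y v)"
  shows "smooth_on S (\<lambda>y. inv (L y) w)"
proof -
  note cont = smooth_on_imp_continuous_on[OF smooth]
  have "Ck_on k S (\<lambda>y. inv (L y) w)" for k
  proof (induction k arbitrary: w)
    case 0
    then show ?case
      using continuous_inv_linear_family[OF S _ lin inj cont]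
      by (simp add: continuous_at_imp_continuous_on)
  next
    case (Suc k)
    let ?L' = "\<lambda>x v. frechet_derivative (\<lambda>y. L y v) (at x)"
    have *: "Ck_on k S (\<lambda>x. - (\<Sum>b\<in>Basis.
        (\<Sum>c\<in>Basis. (inv (L x) w \<bullet> c) *\<^sub>R (?L' x c v \<bullet> b)) *\<^sub>R inv (L x) b))" for v
      by (intro Ck_on_bounded_linear_comp[OF bounded_linear_minus[OF bounded_linear_ident] S]
          Ck_on_sum[OF S] Ck_on_bounded_bilinear[OF bounded_bilinear_scaleR S]
          Ck_on_bounded_linear_comp[OF bounded_linear_inner_left S] Suc.IH
          smooth_on_imp_Ck_on[OF smooth_on_derivative[OF smooth]])
    show ?case
      by (rule Ck_on_SucI[OF S has_derivative_inv_linear_family[OF S _ lin inj cont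
            smooth_on_imp_has_derivative[OF smooth]] *])
  qed
  then show ?thesis by (simp add: smooth_on_def)
qed

section \<open>Smooth atlases\<close>

locale atlas =
  fixes M :: "('a, 'i, 'e::euclidean_space) charted_set"
  assumes smooth_atlas: "smooth_atlas M"
begin

abbreviation overlap :: "'i \<Rightarrow> 'i \<Rightarrow> 'e set"
  where "overlap i j \<equiv> coord M i ` (domain M i \<inter> domain M j)"

abbreviation jac :: "'i \<Rightarrow> 'i \<Rightarrow> 'a \<Rightarrow> 'e \<Rightarrow> 'e"
  where "jac i j p \<equiv> frechet_derivative (transition M i j) (at (coord M i p))"

abbreviation rep :: "('a \<Rightarrow> 'i \<Rightarrow> 'e) \<Rightarrow> 'i \<Rightarrow> 'e \<Rightarrow> 'e"
  where "rep A i \<equiv> \<lambda>x. A (chart_inv M i x) i"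

lemma charts_at_iff: "i \<in> charts_at M p \<longleftrightarrow> i \<in> indices M \<and> p \<in> domain M i"
  by (auto simp: charts_at_def)

lemma coord_inj: "i \<in> indices M \<Longrightarrow> inj_on (coord M i) (domain M i)"
  using smooth_atlas by (auto simp: smooth_atlas_def)

lemma open_overlap: "i \<in> indices M \<Longrightarrow> j \<in> indices M \<Longrightarrow> open (overlap i j)"
  using smooth_atlas by (auto simp: smooth_atlas_def)

lemma open_chart_image: "i \<in> indices M \<Longrightarrow> open (chart_image M i)"
  using open_overlap[of i i] by (simp add: chart_image_def)

lemma smooth_on_transition:
  "i \<in> indices M \<Longrightarrow> j \<in> indices M \<Longrightarrow> smooth_on (overlap i j) (transition M i j)"
  using smooth_atlas by (auto simp: smooth_atlas_def)

lemma chart_inv_coord: "i \<in> charts_at M p \<Longrightarrow> chart_inv M i (coord M i p) = p"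
  by (simp add: charts_at_iff chart_inv_def coord_inj inv_into_f_f)

lemma transition_coord: "i \<in> charts_at M p \<Longrightarrow> transition M i j (coord M i p) = coord M j p"
  by (simp add: transition_def chart_inv_coord)

lemma chart_image_cases:
  assumes "x \<in> chart_image M i" "i \<in> indices M"
  obtains p where "i \<in> charts_at M p" "x = coord M i p" "chart_inv M i x = p"
  using assms chart_inv_coord by (auto simp: chart_image_def charts_at_iff)

lemma points_iff: "p \<in> points M \<longleftrightarrow> charts_at M p \<noteq> {}"
  using smooth_atlas by (auto simp: smooth_atlas_def charts_at_def)

lemma coord_in_chart_image: "i \<in> charts_at M p \<Longrightarrow> coord M i p \<in> chart_image M i"
  by (auto simp: chart_image_def charts_at_iff)

lemma coord_in_overlap:
  "i \<in> charts_at M p \<Longrightarrow> j \<in> charts_at M p \<Longrightarrow> coord M i p \<in> overlap i j"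
  by (auto simp: charts_at_iff)

lemma has_derivative_transition:
  assumes "i \<in> charts_at M p" "j \<in> charts_at M p"
  shows "(transition M i j has_derivative jac i j p) (at (coord M i p))"
  using assms
  by (intro smooth_on_imp_has_derivative[OF smooth_on_transition]) (auto simp: charts_at_iff)

lemma linear_jac: "i \<in> charts_at M p \<Longrightarrow> j \<in> charts_at M p \<Longrightarrow> linear (jac i j p)"
  using has_derivative_transition has_derivative_linear by blast

lemma jac_self:
  assumes "i \<in> charts_at M p"
  shows "jac i i p = (\<lambda>v. v)"
proof -
  have "jac i i p = frechet_derivative (\<lambda>x. x) (at (coord M i p))"
    using assms
    by (intro frechet_derivative_cong_open[OF open_chart_image[of i]])
      (auto simp: charts_at_iff coord_in_chart_image elim!: chart_image_cases intro!: transition_coord)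
  then show ?thesis by simp
qed

text \<open>The cocycle rule is the chain rule; the two transition maps to be compared agree on the
  part of chart \<open>i\<close> that lies in both other domains.\<close>

lemma jac_jac:
  assumes "i \<in> charts_at M p" "j \<in> charts_at M p" "k \<in> charts_at M p"
  shows "jac j k p (jac i j p v) = jac i k p v"
proof -
  have ind: "i \<in> indices M" "j \<in> indices M" "k \<in> indices M" using assms by (auto simp: charts_at_iff)
  have "((\<lambda>x. transition M j k (transition M i j x)) has_derivative (\<lambda>v. jac j k p (jac i j p v)))
      (at (coord M i p))"
    using has_derivative_compose[OF has_derivative_transition[OF assms(1,2)]]
      has_derivative_transition[OF assms(2,3)] transition_coord[OF assms(1)] by metis
  then have "(transition M i k has_derivative (\<lambda>v. jac j k p (jac i j p v))) (at (coord M i p))"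
  proof (rule has_derivative_transform_within_open)
    show "open (overlap i j \<inter> overlap i k)" using ind by (intro open_Int open_overlap)
    show "coord M i p \<in> overlap i j \<inter> overlap i k" using assms coord_in_overlap by blast
    fix x assume "x \<in> overlap i j \<inter> overlap i k"
    then obtain q where "x = coord M i q" "i \<in> charts_at M q" "j \<in> charts_at M q" "k \<in> charts_at M q"
      using coord_inj[OF ind(1)] ind by (auto simp: charts_at_iff inj_on_def)
    then show "transition M j k (transition M i j x) = transition M i k x"
      by (simp add: transition_coord)
  qed
  from frechet_derivative_at[OF this] show ?thesis by metis
qed

section \<open>Tangent spaces as real vector spaces\<close>

lemma tangent_spaceD:
  assumes "v \<in> tangent_space M p"
  shows "i \<notin> charts_at M p \<Longrightarrow> v i = 0"
    and "i \<in> charts_at M p \<Longrightarrow> j \<in> charts_at M p \<Longrightarrow> v j = jac i j p (v i)"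
  using assms unfolding tangent_space_def by blast+

lemma tangent_spaceI:
  assumes "\<And>i. i \<notin> charts_at M p \<Longrightarrow> v i = 0"
    and "\<And>i j. i \<in> charts_at M p \<Longrightarrow> j \<in> charts_at M p \<Longrightarrow> v j = jac i j p (v i)"
  shows "v \<in> tangent_space M p"
  using assms unfolding tangent_space_def by blast

text \<open>The other components are images of the given one under the Jacobians, and outside the
  charts at \<open>p\<close> all are 0. Equations between tangent vectors are thereby checked in a
  single chart.\<close>

lemma tangent_space_eqI:
  assumes "v \<in> tangent_space M p" "w \<in> tangent_space M p" "i \<in> charts_at M p" "v i = w i"
  shows "v = w"
proof
  fix j show "v j = w j"
    using tangent_spaceD[OF assms(1)] tangent_spaceD[OF assms(2)] assms(3,4)
    by (cases "j \<in> charts_at M p") metis+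
qed

lemma coord_vector_in_tangent_space:
  "i \<in> charts_at M p \<Longrightarrow> coord_vector M i p w \<in> tangent_space M p"
  by (auto simp: tangent_space_def coord_vector_def jac_jac)

lemma coord_vector_same: "i \<in> charts_at M p \<Longrightarrow> coord_vector M i p w i = w"
  by (simp add: coord_vector_def jac_self)

lemma coord_vector_component:
  "v \<in> tangent_space M p \<Longrightarrow> i \<in> charts_at M p \<Longrightarrow> coord_vector M i p (v i) = v"
  by (rule tangent_space_eqI) (auto simp: coord_vector_in_tangent_space coord_vector_same)

lemma tangent_space_zero: "0 \<in> tangent_space M p"
  by (auto simp: tangent_space_def linear_0[OF linear_jac])

lemma tangent_space_add:
  assumes "v \<in> tangent_space M p" "w \<in> tangent_space M p"
  shows "v + w \<in> tangent_space M p"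
proof (rule tangent_spaceI)
  fix i j assume ij: "i \<in> charts_at M p" "j \<in> charts_at M p"
  show "(v + w) j = jac i j p ((v + w) i)"
    unfolding plus_fun_apply linear_add[OF linear_jac[OF ij]]
    using tangent_spaceD(2)[OF assms(1) ij] tangent_spaceD(2)[OF assms(2) ij] by (rule arg_cong2)
qed (simp add: assms[THEN tangent_spaceD(1)])

lemma tangent_space_scaleR:
  assumes "v \<in> tangent_space M p"
  shows "c *\<^sub>R v \<in> tangent_space M p"
proof (rule tangent_spaceI)
  fix i j assume ij: "i \<in> charts_at M p" "j \<in> charts_at M p"
  show "(c *\<^sub>R v) j = jac i j p ((c *\<^sub>R v) i)"
    unfolding scaleR_fun_def linear_scale[OF linear_jac[OF ij]]
    using tangent_spaceD(2)[OF assms ij] by (rule arg_cong)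
qed (simp add: assms[THEN tangent_spaceD(1)] scaleR_fun_def)

lemma tangent_space_uminus: "v \<in> tangent_space M p \<Longrightarrow> - v \<in> tangent_space M p"
  using tangent_space_scaleR[of v p "-1"] by simp

lemma tangent_space_diff:
  "v \<in> tangent_space M p \<Longrightarrow> w \<in> tangent_space M p \<Longrightarrow> v - w \<in> tangent_space M p"
  using tangent_space_add[of v p "- w"] tangent_space_uminus[of w p] by simp

lemma coord_vector_add:
  "i \<in> charts_at M p \<Longrightarrow> coord_vector M i p (v + w) = coord_vector M i p v + coord_vector M i p w"
  by (auto simp: coord_vector_def linear_add[OF linear_jac] fun_eq_iff)

lemma coord_vector_scaleR:
  "i \<in> charts_at M p \<Longrightarrow> coord_vector M i p (c *\<^sub>R w) = c *\<^sub>R coord_vector M i p w"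
  by (auto simp: coord_vector_def linear_scale[OF linear_jac] fun_eq_iff scaleR_fun_def)

section \<open>Vector fields and their Lie bracket in charts\<close>

lemma vector_field_tangent: "vector_field M A \<Longrightarrow> i \<in> charts_at M p \<Longrightarrow> A p \<in> tangent_space M p"
  using points_iff by (auto simp: vector_field_def)

lemma smooth_on_rep:
  "vector_field M A \<Longrightarrow> i \<in> indices M \<Longrightarrow> smooth_on (chart_image M i) (rep A i)"
  by (simp add: vector_field_def)

lemma has_derivative_rep:
  "vector_field M A \<Longrightarrow> i \<in> charts_at M p \<Longrightarrow>
    (rep A i has_derivative frechet_derivative (rep A i) (at (coord M i p))) (at (coord M i p))"
  by (rule smooth_on_imp_has_derivative[OF smooth_on_rep])
    (auto simp: coord_in_chart_image charts_at_iff)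

lemma linear_derivative_rep:
  "vector_field M A \<Longrightarrow> i \<in> charts_at M p \<Longrightarrow>
    linear (frechet_derivative (rep A i) (at (coord M i p)))"
  using has_derivative_rep has_derivative_linear by blast

lemma vector_field_add:
  assumes "vector_field M A" "vector_field M B"
  shows "vector_field M (A + B)"
  using assms
  by (auto simp: vector_field_def intro!: tangent_space_add smooth_on_add open_chart_image)

lemma vector_field_uminus:
  assumes "vector_field M A"
  shows "vector_field M (- A)"
  using assms
  by (auto simp: vector_field_def intro!: tangent_space_uminus smooth_on_uminus open_chart_image)

text \<open>Inverse charts take the open chart image into \<open>points M\<close>, so derivatives of
  components do not see the arbitrary values elsewhere.\<close>

lemma rep_cong:
  assumes "\<And>p. p \<in> points M \<Longrightarrow> A p = B p" "i \<in> charts_at M p"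
  shows "frechet_derivative (rep A i) (at (coord M i p)) =
    frechet_derivative (rep B i) (at (coord M i p))"
proof (rule frechet_derivative_cong_open)
  show "open (chart_image M i)" using assms by (simp add: open_chart_image charts_at_iff)
  show "coord M i p \<in> chart_image M i" by (rule coord_in_chart_image[OF assms(2)])
  show "rep A i x = rep B i x" if x: "x \<in> chart_image M i" for x
  proof -
    obtain q where q: "i \<in> charts_at M q" "chart_inv M i x = q"
      using x assms(2) by (auto simp: charts_at_iff elim!: chart_image_cases)
    then have "q \<in> points M" using points_iff by blast
    then show ?thesis using assms(1) q(2) by simp
  qed
qed

lemma lie_bracket_component:
  "i \<in> charts_at M p \<Longrightarrow> lie_bracket M A B p i =
    frechet_derivative (rep B i) (at (coord M i p)) (A p i) -
    frechet_derivative (rep A i) (at (coord M i p)) (B p i)"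
  by (simp add: lie_bracket_def)

lemma lie_bracket_cong:
  assumes "\<And>p. p \<in> points M \<Longrightarrow> A p = A' p" "\<And>p. p \<in> points M \<Longrightarrow> B p = B' p" "p \<in> points M"
  shows "lie_bracket M A B p = lie_bracket M A' B' p"
  using rep_cong[of A A'] rep_cong[of B B'] assms by (auto simp: lie_bracket_def fun_eq_iff)

lemma lie_bracket_antisym: "lie_bracket M B A = - lie_bracket M A B"
  by (auto simp: lie_bracket_def fun_eq_iff)

lemma lie_bracket_add_left:
  assumes "vector_field M A" "vector_field M A'" "vector_field M B" "p \<in> points M"
  shows "lie_bracket M (A + A') B p = lie_bracket M A B p + lie_bracket M A' B p"
proof
  fix i
  show "lie_bracket M (A + A') B p i = (lie_bracket M A B p + lie_bracket M A' B p) i"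
  proof (cases "i \<in> charts_at M p")
    case True
    have "((\<lambda>x. rep A i x + rep A' i x) has_derivative
        (\<lambda>v. frechet_derivative (rep A i) (at (coord M i p)) v +
          frechet_derivative (rep A' i) (at (coord M i p)) v)) (at (coord M i p))"
      by (intro has_derivative_add has_derivative_rep assms True)
    from frechet_derivative_at[OF this, symmetric] show ?thesis
      using True linear_add[OF linear_derivative_rep[OF assms(3) True]]
      by (simp add: lie_bracket_component)
  qed (simp add: lie_bracket_def)
qed

text \<open>Second derivatives of the transition map enter symmetrically, so they cancel in the
  bracket.\<close>

lemma derivative_rep_transition:
  assumes "vector_field M A" "i \<in> charts_at M p" "j \<in> charts_at M p"
  shows "frechet_derivative (rep A j) (at (coord M j p)) (jac i j p v) =
    frechet_derivative (\<lambda>x. frechet_derivative (transition M i j) (at x) (A p i)) (at (coord M i p)) v +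
    jac i j p (frechet_derivative (rep A i) (at (coord M i p)) v)"
proof -
  let ?x = "coord M i p"
  have ind: "i \<in> indices M" "j \<in> indices M" using assms by (auto simp: charts_at_iff)
  \<comment> \<open>The components of A in chart \<open>j\<close>, composed with the transition map,
    equal the Jacobian applied to the components in chart \<open>i\<close>. The formula arises by
    differentiating both expressions.\<close>
  have "((\<lambda>x. rep A j (transition M i j x)) has_derivative
      (\<lambda>v. frechet_derivative (rep A j) (at (coord M j p)) (jac i j p v))) (at ?x)"
    by (rule has_derivative_compose[OF has_derivative_transition[OF assms(2,3)]])
      (unfold transition_coord[OF assms(2)], rule has_derivative_rep[OF assms(1,3)])
  then have "frechet_derivative (\<lambda>x. rep A j (transition M i j x)) (at ?x) =
      (\<lambda>v. frechet_derivative (rep A j) (at (coord M j p)) (jac i j p v))"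
    by (rule frechet_derivative_at[symmetric])
  moreover have "frechet_derivative (\<lambda>x. rep A j (transition M i j x)) (at ?x) =
     frechet_derivative (\<lambda>x. frechet_derivative (transition M i j) (at x) (rep A i x)) (at ?x)"
  proof (rule frechet_derivative_cong_open[OF open_overlap[OF ind] coord_in_overlap[OF assms(2,3)]])
    fix x assume "x \<in> overlap i j"
    then obtain q where q: "x = coord M i q" "i \<in> charts_at M q" "j \<in> charts_at M q"
      using ind by (auto simp: charts_at_iff)
    then show "rep A j (transition M i j x) = frechet_derivative (transition M i j) (at x) (rep A i x)"
      using tangent_spaceD(2)[OF vector_field_tangent[OF assms(1) q(2)] q(2,3)]
      by (simp add: transition_coord chart_inv_coord)
  qed
  moreover have "smooth_on (overlap i j) (rep A i)"
    by (rule smooth_on_subset[OF smooth_on_rep[OF assms(1) ind(1)]]) (auto simp: chart_image_def)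
  note derivative_of_directional_derivative[OF open_overlap[OF ind] coord_in_overlap[OF assms(2,3)]
    smooth_on_transition[OF ind] this, of v]
  ultimately show ?thesis by (simp add: chart_inv_coord[OF assms(2)])
qed

lemma lie_bracket_tangent:
  assumes "vector_field M A" "vector_field M B"
  shows "lie_bracket M A B p \<in> tangent_space M p"
proof (rule tangent_spaceI)
  fix i assume "i \<notin> charts_at M p"
  then show "lie_bracket M A B p i = 0" by (simp add: lie_bracket_def)
next
  fix i j assume ij: "i \<in> charts_at M p" "j \<in> charts_at M p"
  then have ind: "i \<in> indices M" "j \<in> indices M" by (auto simp: charts_at_iff)
  have A: "A p j = jac i j p (A p i)" and B: "B p j = jac i j p (B p i)"
    using assms[THEN vector_field_tangent, OF ij(1), THEN tangent_spaceD(2)] ij by blast+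
  show "lie_bracket M A B p j = jac i j p (lie_bracket M A B p i)"
    \<comment> \<open>The chosen instance of symmetry rewrites only the second derivative that comes
      from B; it then coincides with the one from A and drops out of the difference.\<close>
    unfolding lie_bracket_component[OF ij(1)] lie_bracket_component[OF ij(2)] A B
      derivative_rep_transition[OF assms(1) ij] derivative_rep_transition[OF assms(2) ij]
      symmetric_second_derivative[OF open_overlap[OF ind] coord_in_overlap[OF ij]
        smooth_on_transition[OF ind], of "B p i" "A p i"]
    by (simp add: linear_diff[OF linear_jac[OF ij]])
qed

lemma vector_field_lie_bracket:
  assumes "vector_field M A" "vector_field M B"
  shows "vector_field M (lie_bracket M A B)"
  unfolding vector_field_def
proof (intro conjI ballI)
  fix i assume i: "i \<in> indices M"
  have "smooth_on (chart_image M i) (\<lambda>x. frechet_derivative (rep B i) (at x) (rep A i x) -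
      frechet_derivative (rep A i) (at x) (rep B i x))"
    using assms i
    by (intro smooth_on_diff smooth_on_derivative_along smooth_on_rep open_chart_image)
  moreover have "frechet_derivative (rep B i) (at x) (rep A i x) -
      frechet_derivative (rep A i) (at x) (rep B i x) = rep (lie_bracket M A B) i x"
    if "x \<in> chart_image M i" for x
    using that i by (auto simp: lie_bracket_component elim!: chart_image_cases)
  ultimately show "smooth_on (chart_image M i) (rep (lie_bracket M A B) i)"
    using smooth_on_cong[OF open_chart_image[OF i]] by (metis (no_types, lifting))
qed (rule lie_bracket_tangent[OF assms])

text \<open>Product rule for b'(a) - a'(b), where a and b represent A and B: each term yields a
  second derivative and a composite of first derivatives.\<close>

lemma derivative_rep_lie_bracket:
  assumes "vector_field M A" "vector_field M B" "i \<in> charts_at M p"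
  shows "frechet_derivative (rep (lie_bracket M A B) i) (at (coord M i p)) v =
    frechet_derivative (\<lambda>x. frechet_derivative (rep B i) (at x) (A p i)) (at (coord M i p)) v +
    frechet_derivative (rep B i) (at (coord M i p)) (frechet_derivative (rep A i) (at (coord M i p)) v) -
    (frechet_derivative (\<lambda>x. frechet_derivative (rep A i) (at x) (B p i)) (at (coord M i p)) v +
    frechet_derivative (rep A i) (at (coord M i p)) (frechet_derivative (rep B i) (at (coord M i p)) v))"
proof -
  let ?x = "coord M i p" and ?S = "chart_image M i"
  have i: "i \<in> indices M" using assms by (auto simp: charts_at_iff)
  note S = open_chart_image[OF i] coord_in_chart_image[OF assms(3)]
  note AB = smooth_on_rep[OF assms(1) i] smooth_on_rep[OF assms(2) i]
  let ?f = "\<lambda>x. frechet_derivative (rep B i) (at x) (rep A i x)"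
  let ?g = "\<lambda>x. frechet_derivative (rep A i) (at x) (rep B i x)"
  have "frechet_derivative (rep (lie_bracket M A B) i) (at ?x) =
      frechet_derivative (\<lambda>x. ?f x - ?g x) (at ?x)"
    by (rule frechet_derivative_cong_open[OF S])
      (use i in \<open>auto simp: lie_bracket_component elim!: chart_image_cases\<close>)
  also have "\<dots> = (\<lambda>v. frechet_derivative ?f (at ?x) v - frechet_derivative ?g (at ?x) v)"
    by (rule frechet_derivative_at[symmetric], rule has_derivative_diff;
        rule smooth_on_imp_has_derivative[OF smooth_on_derivative_along S(2)]; rule S AB)
  finally show ?thesis
    by (simp add: derivative_of_directional_derivative[OF S AB(1) AB(2)]
        derivative_of_directional_derivative[OF S AB(2) AB(1)] chart_inv_coord[OF assms(3)])
qed

text \<open>Over the cyclic sum the composites of first derivatives cancel by linearity. The second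
  derivatives of each field occur twice, with opposite signs and exchanged directions, so one
  instance of symmetry per field is used.\<close>

lemma lie_bracket_jacobi:
  assumes "vector_field M A" "vector_field M B" "vector_field M C"
  shows "lie_bracket M (lie_bracket M A B) C p + lie_bracket M (lie_bracket M B C) A p +
    lie_bracket M (lie_bracket M C A) B p = 0"
proof
  fix i
  show "(lie_bracket M (lie_bracket M A B) C p + lie_bracket M (lie_bracket M B C) A p +
    lie_bracket M (lie_bracket M C A) B p) i = 0 i"
  proof (cases "i \<in> charts_at M p")
    case True
    then have i: "i \<in> indices M" by (auto simp: charts_at_iff)
    note S = open_chart_image[OF i] coord_in_chart_image[OF True]
    note sym = symmetric_second_derivative[OF S smooth_on_rep[OF _ i]]
    note lin = linear_diff[OF linear_derivative_rep[OF _ True]]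
    show ?thesis
      using sym[OF assms(1), of "B p i" "C p i"] sym[OF assms(2), of "C p i" "A p i"]
        sym[OF assms(3), of "A p i" "B p i"]
      by (simp add: lie_bracket_component[OF True] derivative_rep_lie_bracket True assms lin)
  qed (simp add: lie_bracket_def)
qed

end

section \<open>The slit tangent bundle\<close>

lemma slit_tangent_bundle_simps [simp]:
  "points (slit_tangent_bundle M) = {(p, v). p \<in> points M \<and> v \<in> tangent_space M p \<and> v \<noteq> 0}"
  "indices (slit_tangent_bundle M) = indices M"
  "domain (slit_tangent_bundle M) i =
    {(p, v). p \<in> domain M i \<and> v \<in> tangent_space M p \<and> v \<noteq> 0}"
  "coord (slit_tangent_bundle M) i u = (coord M i (fst u), snd u i)"
  by (auto simp: slit_tangent_bundle_def split: prod.splits)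

context atlas
begin

text \<open>A tangent vector is nonzero iff its component in one chart is, and
  \<open>coord_vector\<close> realises every nonzero component. Hence the overlaps are open
  products.\<close>

lemma slit_overlap:
  assumes "i \<in> indices M" "j \<in> indices M"
  shows "coord (slit_tangent_bundle M) i `
    (domain (slit_tangent_bundle M) i \<inter> domain (slit_tangent_bundle M) j) = overlap i j \<times> (- {0})"
    (is "?L = ?R")
proof (intro set_eqI iffI)
  fix z assume "z \<in> ?L"
  then obtain p v where z: "z = (coord M i p, v i)" "p \<in> domain M i" "p \<in> domain M j"
    and v: "v \<in> tangent_space M p" "v \<noteq> 0" by auto
  have "v i \<noteq> 0"
    using tangent_space_eqI[OF v(1) tangent_space_zero, of i] v(2) z(2) assms(1)
    by (auto simp: charts_at_iff)
  then show "z \<in> ?R" using z by auto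
next
  fix z assume "z \<in> ?R"
  then obtain p y where z: "z = (coord M i p, y)" "p \<in> domain M i" "p \<in> domain M j" "y \<noteq> 0" by auto
  have i: "i \<in> charts_at M p" using z assms by (simp add: charts_at_iff)
  let ?v = "coord_vector M i p y"
  have v: "?v \<in> tangent_space M p" "?v i = y"
    using i by (auto simp: coord_vector_in_tangent_space coord_vector_same)
  have "?v \<noteq> 0"
  proof
    assume "?v = 0"
    then have "?v i = 0" by (simp only: zero_fun_apply)
    then show False using v(2) z(4) by simp
  qed
  then show "z \<in> ?L" using v z by (intro image_eqI[of _ _ "(p, ?v)"]) auto
qed

lemma slit_coord_inj:
  assumes "i \<in> indices M"
  shows "inj_on (coord (slit_tangent_bundle M) i) (domain (slit_tangent_bundle M) i)"
proof (rule inj_onI)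
  fix u w assume *: "u \<in> domain (slit_tangent_bundle M) i" "w \<in> domain (slit_tangent_bundle M) i"
    "coord (slit_tangent_bundle M) i u = coord (slit_tangent_bundle M) i w"
  then have "fst u = fst w"
    using coord_inj[OF assms] by (auto simp: inj_on_def split: prod.splits)
  moreover have "snd u = snd w"
    using * calculation assms by (intro tangent_space_eqI[of "snd u" "fst u" "snd w" i]) (auto simp: charts_at_iff)
  ultimately show "u = w" by (rule prod_eqI)
qed

lemma slit_transition:
  assumes "i \<in> indices M" "j \<in> indices M" "z \<in> overlap i j \<times> (- {0})"
  shows "transition (slit_tangent_bundle M) i j z =
    (transition M i j (fst z), frechet_derivative (transition M i j) (at (fst z)) (snd z))"
proof -
  obtain u where u: "u \<in> domain (slit_tangent_bundle M) i" "u \<in> domain (slit_tangent_bundle M) j"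
    "z = coord (slit_tangent_bundle M) i u"
    using assms(3) unfolding slit_overlap[OF assms(1,2), symmetric] by blast
  have ij: "i \<in> charts_at M (fst u)" "j \<in> charts_at M (fst u)"
    using u assms by (auto simp: charts_at_iff)
  have "chart_inv (slit_tangent_bundle M) i z = u"
    unfolding chart_inv_def u(3) using slit_coord_inj[OF assms(1)] u(1) by (rule inv_into_f_f)
  then have "transition (slit_tangent_bundle M) i j z = coord (slit_tangent_bundle M) j u"
    by (simp only: transition_def o_apply)
  moreover have "snd u j = jac i j (fst u) (snd u i)"
    using u(1) by (intro tangent_spaceD(2)[OF _ ij]) auto
  ultimately show ?thesis using u(3) transition_coord[OF ij(1)] by simp
qed

lemma linear_transition_derivative:
  "i \<in> indices M \<Longrightarrow> j \<in> indices M \<Longrightarrow> x \<in> overlap i j \<Longrightarrow>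
    linear (frechet_derivative (transition M i j) (at x))"
  by (rule linear_frechet_derivative_smooth_on[OF smooth_on_transition])

text \<open>Bundle transitions are the tangent maps (\<tau>(x), \<tau>'(x)y). They are smooth
  because \<tau> and its derivatives along fixed vectors are, and \<tau>'(x) is linear in y.\<close>

lemma slit_atlas: "atlas (slit_tangent_bundle M)"
proof
  let ?N = "slit_tangent_bundle M"
  have "(\<Union>i\<in>indices ?N. domain ?N i) = points ?N"
    using smooth_atlas by (auto simp: smooth_atlas_def)
  moreover have "open (overlap i j \<times> (- {0 :: 'e})) \<and>
      smooth_on (overlap i j \<times> (- {0 :: 'e})) (transition ?N i j)"
    if ij: "i \<in> indices M" "j \<in> indices M" for i j
  proof
    let ?S = "overlap i j \<times> (- {0 :: 'e})"
    show S: "open ?S" by (intro open_Times open_overlap ij open_Compl closed_singleton)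
    have smooth_fst: "smooth_on ?S (\<lambda>z. f (fst z))" if "smooth_on (overlap i j) f" for f :: "'e \<Rightarrow> 'e"
      by (rule smooth_on_comp_bounded_linear[OF bounded_linear_fst S _ that]) auto
    have "smooth_on ?S (\<lambda>z. frechet_derivative (transition M i j) (at (fst z)) (snd z))"
    proof (rule smooth_on_apply_linear[OF S,
          where L = "\<lambda>z. frechet_derivative (transition M i j) (at (fst z))" and g = snd])
      show "linear (frechet_derivative (transition M i j) (at (fst z)))" if "z \<in> ?S" for z
        using that by (intro linear_transition_derivative[OF ij]) auto
    qed (intro smooth_fst smooth_on_derivative smooth_on_transition ij
        smooth_on_bounded_linear S bounded_linear_snd)+
    then have "smooth_on ?S (\<lambda>z. (transition M i j (fst z),
        frechet_derivative (transition M i j) (at (fst z)) (snd z)))"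
      by (intro smooth_on_Pair S smooth_fst smooth_on_transition ij)
    then show "smooth_on ?S (transition ?N i j)"
      using smooth_on_cong[OF S, of "transition ?N i j", OF slit_transition[OF ij]] by (simp only:)
  qed
  ultimately show "smooth_atlas ?N"
    unfolding smooth_atlas_def by (auto simp only: slit_tangent_bundle_simps(2) slit_overlap slit_coord_inj)
qed

end

text \<open>A locale of its own: the sublocale declaration below, made for \<open>atlas\<close>
  itself, would apply to the new atlas again and produce bundles of bundles without end.\<close>

locale slit_bundle = atlas M for M :: "('a, 'i, 'e::euclidean_space) charted_set"
begin

abbreviation N where "N \<equiv> slit_tangent_bundle M"

end

sublocale slit_bundle \<subseteq> slit: atlas "slit_tangent_bundle M"
  by (rule slit_atlas)

context slit_bundle
begin

section \<open>The projection and the vertical lift in bundle charts\<close>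

lemma charts_at_slit: "i \<in> charts_at N u \<longleftrightarrow> u \<in> points N \<and> i \<in> charts_at M (fst u)"
  using points_iff by (auto simp: charts_at_iff slit.charts_at_iff)

lemma charts_atD:
  assumes "i \<in> charts_at N u"
  shows "u \<in> points N" "i \<in> charts_at M (fst u)" "snd u \<in> tangent_space M (fst u)"
  using assms by (auto simp: charts_at_slit)

lemma obtain_chart:
  assumes "u \<in> points N"
  obtains i where "i \<in> charts_at N u"
  using assms slit.points_iff by blast

text \<open>The derivative of (\<tau>(x), \<tau>'(x)y) is block triangular with the Jacobian in both
  diagonal blocks. So first components transform like tangent vectors of M, as needed for \<rho>,
  and vectors (0, v) keep their form, as needed for \<gamma>.\<close>

lemma slit_jac:
  assumes "i \<in> charts_at N u" "j \<in> charts_at N u"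
  shows "slit.jac i j u w = (jac i j (fst u) (fst w),
    frechet_derivative (\<lambda>x. frechet_derivative (transition M i j) (at x) (snd u i))
      (at (coord M i (fst u))) (fst w) + jac i j (fst u) (snd w))"
proof -
  let ?S = "overlap i j \<times> (- {0 :: 'e})" and ?z = "coord N i u" and ?\<tau> = "transition M i j"
  let ?d = "\<lambda>y x. frechet_derivative ?\<tau> (at x) y"
  have ind: "i \<in> indices M" "j \<in> indices M" using assms by (auto simp: slit.charts_at_iff)
  note ch = charts_atD(2)[OF assms(1)] charts_atD(2)[OF assms(2)]
  have S: "open ?S" by (intro open_Times open_overlap ind open_Compl closed_singleton)
  have z: "?z \<in> ?S"
    using slit.coord_in_overlap[OF assms] unfolding slit_overlap[OF ind] .
  have x: "fst ?z \<in> overlap i j" using z by auto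
  have d: "((\<lambda>z. f (fst z)) has_derivative (\<lambda>w. frechet_derivative f (at (fst ?z)) (fst w))) (at ?z)"
    if "smooth_on (overlap i j) f" for f :: "'e \<Rightarrow> 'e"
    by (rule has_derivative_compose[OF bounded_linear_imp_has_derivative[OF bounded_linear_fst]
          smooth_on_imp_has_derivative[OF that x]])
  have dd: "((\<lambda>z. ?d y (fst z)) has_derivative
      (\<lambda>w. frechet_derivative (?d y) (at (fst ?z)) (fst w))) (at ?z)" for y
    by (rule d[OF smooth_on_derivative[OF smooth_on_transition[OF ind]]])
  have "((\<lambda>z. ?d (snd z) (fst z)) has_derivative
      (\<lambda>w. frechet_derivative (\<lambda>z. ?d (snd ?z) (fst z)) (at ?z) w + ?d (snd w) (fst ?z))) (at ?z)"
  proof (rule linear_family_derivative[where L = "\<lambda>z y. ?d y (fst z)" and g = snd, OF S z])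
    show "linear (\<lambda>y. ?d y (fst z))" if "z \<in> ?S" for z
      using that by (intro linear_transition_derivative[OF ind]) auto
    show "(\<lambda>z. ?d y (fst z)) differentiable (at ?z)" for y
      by (rule differentiableI[OF dd])
    show "(snd has_derivative snd) (at ?z)"
      by (rule bounded_linear_imp_has_derivative[OF bounded_linear_snd])
  qed
  then have "((\<lambda>z. (?\<tau> (fst z), ?d (snd z) (fst z))) has_derivative
     (\<lambda>w. (frechet_derivative ?\<tau> (at (fst ?z)) (fst w),
       frechet_derivative (\<lambda>z. ?d (snd ?z) (fst z)) (at ?z) w + ?d (snd w) (fst ?z)))) (at ?z)"
    by (rule has_derivative_Pair[OF d[OF smooth_on_transition[OF ind]]])
  then have "(transition N i j has_derivative
     (\<lambda>w. (frechet_derivative ?\<tau> (at (fst ?z)) (fst w),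
       frechet_derivative (\<lambda>z. ?d (snd ?z) (fst z)) (at ?z) w + ?d (snd w) (fst ?z)))) (at ?z)"
    by (rule has_derivative_transform_within_open[OF _ S z]) (rule slit_transition[OF ind, symmetric])
  from fun_cong[OF frechet_derivative_at[OF this], of w, symmetric]
    fun_cong[OF frechet_derivative_at[OF dd[of "snd ?z"]], of w, symmetric]
  show ?thesis by simp
qed

text \<open>\<open>differential\<close> computes in an arbitrarily chosen chart. Tangency of
  \<open>A\<close> removes the choice: the first component of the transition derivative, applied to
  \<open>A i\<close>, is the first component of \<open>A j\<close>.\<close>

lemma rho_eq:
  assumes "A \<in> tangent_space N u" "u \<in> points N"
  shows "rho M u A = (\<lambda>j. fst (A j))"
proof
  fix j
  define i where "i = (SOME i. i \<in> charts_at N u)"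
  have i: "i \<in> charts_at N u" unfolding i_def using obtain_chart[OF assms(2)] by (metis someI)
  show "rho M u A j = fst (A j)"
  proof (cases "j \<in> charts_at M (fst u)")
    case True
    then have j: "j \<in> charts_at N u" using assms(2) by (simp only: charts_at_slit)
    have "coord M j \<circ> fst \<circ> chart_inv N i = (\<lambda>z. fst (transition N i j z))"
      by (simp add: fun_eq_iff transition_def)
    moreover have "frechet_derivative (\<lambda>z. fst (transition N i j z)) (at (coord N i u)) =
        (\<lambda>w. fst (slit.jac i j u w))"
      by (rule frechet_derivative_bounded_linear_comp[OF bounded_linear_fst
            differentiableI[OF slit.has_derivative_transition[OF i j]]])
    ultimately show ?thesis
      using True slit.tangent_spaceD(2)[OF assms(1) i j]
      by (simp add: rho_def differential_def Let_def i_def[symmetric] del: slit_tangent_bundle_simps)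
  next
    case False
    then have "j \<notin> charts_at N u" by (simp only: charts_at_slit simp_thms)
    then show ?thesis using False slit.tangent_spaceD(1)[OF assms(1)]
      by (simp add: rho_def differential_def Let_def)
  qed
qed

lemma rho_tangent:
  assumes "A \<in> tangent_space N u" "u \<in> points N"
  shows "rho M u A \<in> tangent_space M (fst u)"
  unfolding rho_eq[OF assms]
proof (rule tangent_spaceI)
  fix i assume "i \<notin> charts_at M (fst u)"
  then show "fst (A i) = 0"
    using slit.tangent_spaceD(1)[OF assms(1), of i] charts_atD(2) by fastforce
next
  fix i j assume "i \<in> charts_at M (fst u)" "j \<in> charts_at M (fst u)"
  then have ij: "i \<in> charts_at N u" "j \<in> charts_at N u" using assms(2) by (simp_all only: charts_at_slit)
  show "fst (A j) = jac i j (fst u) (fst (A i))"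
    using slit.tangent_spaceD(2)[OF assms(1) ij] unfolding slit_jac[OF ij] by simp
qed

lemma vertical_lift_eq:
  assumes "v \<in> tangent_space M (fst u)" "u \<in> points N"
  shows "vertical_lift M u v = (\<lambda>i. (0, v i))"
proof
  fix i
  show "vertical_lift M u v i = (0, v i)"
  proof (cases "i \<in> charts_at M (fst u)")
    case True
    then have "i \<in> charts_at N u" using assms(2) by (simp only: charts_at_slit)
    \<comment> \<open>In coordinates the curve is affine for all \<open>t\<close>, even at a
      parameter where the vector vanishes and the curve leaves the slit bundle.\<close>
    moreover have "coord N i \<circ> (\<lambda>t. (fst u, snd u + t *\<^sub>R v)) =
        (\<lambda>t. (coord M i (fst u), snd u i + t *\<^sub>R v i))"
      by (simp add: fun_eq_iff scaleR_fun_def)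
    moreover have "((\<lambda>t. snd u i + t *\<^sub>R v i) has_derivative (\<lambda>h. h *\<^sub>R v i)) (at 0)"
      by (auto intro!: derivative_eq_intros)
    from has_derivative_Pair[OF has_derivative_const this]
    have "((\<lambda>t. (coord M i (fst u), snd u i + t *\<^sub>R v i)) has_vector_derivative (0, v i)) (at 0)"
      by (simp add: has_vector_derivative_def)
    ultimately show ?thesis
      by (simp add: vertical_lift_def velocity_def vector_derivative_at del: slit_tangent_bundle_simps)
  next
    case False
    then have "i \<notin> charts_at N u" by (simp only: charts_at_slit simp_thms)
    then show ?thesis using tangent_spaceD(1)[OF assms(1) False]
      by (simp add: vertical_lift_def velocity_def zero_prod_def del: slit_tangent_bundle_simps)
  qed
qed

lemma vertical_lift_tangent:
  assumes "v \<in> tangent_space M (fst u)" "u \<in> points N"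
  shows "vertical_lift M u v \<in> tangent_space N u"
  unfolding vertical_lift_eq[OF assms]
proof (rule slit.tangent_spaceI)
  fix i assume "i \<notin> charts_at N u"
  then have "i \<notin> charts_at M (fst u)" using assms(2) by (simp only: charts_at_slit simp_thms)
  then show "(0, v i) = 0" using tangent_spaceD(1)[OF assms(1)] by (simp add: zero_prod_def)
next
  fix i j assume ij: "i \<in> charts_at N u" "j \<in> charts_at N u"
  note ch = charts_atD(2)[OF ij(1)] charts_atD(2)[OF ij(2)]
  have ind: "i \<in> indices M" "j \<in> indices M" using ch by (auto simp: charts_at_iff)
  have "linear (frechet_derivative (\<lambda>x. frechet_derivative (transition M i j) (at x) (snd u i))
      (at (coord M i (fst u))))"
    by (rule linear_frechet_derivative_smooth_on[OF smooth_on_derivative[OF smooth_on_transition[OF ind]]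
          coord_in_overlap[OF ch]])
  then show "(0, v j) = slit.jac i j u (0, v i)"
    using tangent_spaceD(2)[OF assms(1) ch] unfolding slit_jac[OF ij]
    by (simp add: linear_0 linear_0[OF linear_jac[OF ch]])
qed

section \<open>Smooth sections of the pullback bundle and smooth fields on the slit bundle\<close>

lemma pi_vector_field_tangent:
  "pi_vector_field M X \<Longrightarrow> u \<in> points N \<Longrightarrow> X u \<in> tangent_space M (fst u)"
  unfolding pi_vector_field_def by blast

lemma smooth_on_pi_rep:
  "pi_vector_field M X \<Longrightarrow> i \<in> indices M \<Longrightarrow>
    smooth_on (chart_image N i) (\<lambda>z. X (chart_inv N i z) i)"
  unfolding pi_vector_field_def by blast

lemma open_slit_chart_image: "i \<in> indices M \<Longrightarrow> open (chart_image N i)"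
  using slit.open_chart_image by simp

lemma slit_chart_image_cases:
  assumes "z \<in> chart_image N i" "i \<in> indices M"
  obtains u where "i \<in> charts_at N u" "z = coord N i u" "chart_inv N i z = u"
proof -
  have "i \<in> indices N" using assms(2) by simp
  show thesis by (rule slit.chart_image_cases[OF assms(1) \<open>i \<in> indices N\<close>]) (rule that)
qed

text \<open>Smoothness may be verified on any coordinate expression \<open>f i\<close> that
  describes X on the chart, since it determines the composite with the inverse chart on an open
  set.\<close>

lemma pi_vector_fieldI:
  assumes "\<And>u. u \<in> points N \<Longrightarrow> X u \<in> tangent_space M (fst u)"
    and "\<And>i. i \<in> indices M \<Longrightarrow> smooth_on (chart_image N i) (f i)"
    and "\<And>i u. i \<in> charts_at N u \<Longrightarrow> X u i = f i (coord N i u)"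
  shows "pi_vector_field M X"
  unfolding pi_vector_field_def
proof (intro conjI ballI assms(1), assumption)
  fix i assume i: "i \<in> indices M"
  have "X (chart_inv N i z) i = f i z" if "z \<in> chart_image N i" for z
    by (rule slit_chart_image_cases[OF that i]) (simp add: assms(3))
  then show "smooth_on (chart_image N i) (\<lambda>z. X (chart_inv N i z) i)"
    using smooth_on_cong[OF open_slit_chart_image[OF i], of _ "f i"] assms(2)[OF i] by simp
qed

lemma slit_vector_fieldI:
  assumes "\<And>u. u \<in> points N \<Longrightarrow> A u \<in> tangent_space N u"
    and "\<And>i. i \<in> indices M \<Longrightarrow> smooth_on (chart_image N i) (f i)"
    and "\<And>i u. i \<in> charts_at N u \<Longrightarrow> A u i = f i (coord N i u)"
  shows "vector_field N A"
  unfolding vector_field_def slit_tangent_bundle_simps(2)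
proof (intro conjI ballI assms(1), assumption)
  fix i assume i: "i \<in> indices M"
  have "A (chart_inv N i z) i = f i z" if "z \<in> chart_image N i" for z
    by (rule slit_chart_image_cases[OF that i]) (simp add: assms(3))
  then show "smooth_on (chart_image N i) (\<lambda>z. A (chart_inv N i z) i)"
    using smooth_on_cong[OF open_slit_chart_image[OF i], of _ "f i"] assms(2)[OF i] by simp
qed

lemma slit_vector_field_tangent: "vector_field N A \<Longrightarrow> u \<in> points N \<Longrightarrow> A u \<in> tangent_space N u"
  unfolding vector_field_def by blast

lemma smooth_on_slit_rep:
  "vector_field N A \<Longrightarrow> i \<in> indices M \<Longrightarrow> smooth_on (chart_image N i) (slit.rep A i)"
  using slit.smooth_on_rep by simp

lemma pi_vector_field_eta: "pi_vector_field M eta"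
proof (rule pi_vector_fieldI)
  show "eta u \<in> tangent_space M (fst u)" if "u \<in> points N" for u
    using that by (auto simp: eta_def)
  show "smooth_on (chart_image N i) snd" if "i \<in> indices M" for i
    by (intro smooth_on_bounded_linear open_slit_chart_image that bounded_linear_snd)
  show "eta u i = snd (coord N i u)" for i u by (simp add: eta_def)
qed

lemma pi_vector_field_zero: "pi_vector_field M 0"
  by (rule pi_vector_fieldI[where f = "\<lambda>i z. 0"])
    (auto simp: tangent_space_zero smooth_on_const)

lemma pi_vector_field_add:
  assumes "pi_vector_field M X" "pi_vector_field M Y"
  shows "pi_vector_field M (X + Y)"
  using assms unfolding pi_vector_field_def
  by (auto intro!: tangent_space_add smooth_on_add open_slit_chart_image
      simp del: slit_tangent_bundle_simps(1))

lemma pi_vector_field_uminus: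
  assumes "pi_vector_field M X"
  shows "pi_vector_field M (- X)"
  using assms unfolding pi_vector_field_def
  by (auto intro!: tangent_space_uminus smooth_on_uminus open_slit_chart_image
      simp del: slit_tangent_bundle_simps(1))

lemma pi_vector_field_diff:
  "pi_vector_field M X \<Longrightarrow> pi_vector_field M Y \<Longrightarrow> pi_vector_field M (X - Y)"
  using pi_vector_field_add[of X "- Y"] pi_vector_field_uminus[of Y] by simp

lemma vector_field_gamma:
  assumes "pi_vector_field M X"
  shows "vector_field N (gamma_field M X)"
proof (rule slit_vector_fieldI)
  show "gamma_field M X u \<in> tangent_space N u" if "u \<in> points N" for u
    unfolding gamma_field_def
    by (rule vertical_lift_tangent[OF pi_vector_field_tangent[OF assms that] that])
  show "smooth_on (chart_image N i) (\<lambda>z. (0, X (chart_inv N i z) i))" if "i \<in> indices M" for i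
    by (intro smooth_on_Pair smooth_on_const open_slit_chart_image smooth_on_pi_rep assms that)
  show "gamma_field M X u i = (0, X (chart_inv N i (coord N i u)) i)" if "i \<in> charts_at N u" for i u
    unfolding gamma_field_def slit.chart_inv_coord[OF that]
    by (simp add: vertical_lift_eq[OF pi_vector_field_tangent[OF assms] ] charts_atD(1)[OF that]
        del: slit_tangent_bundle_simps)
qed

lemma pi_vector_field_rho:
  assumes "vector_field N A"
  shows "pi_vector_field M (rho_field M A)"
proof (rule pi_vector_fieldI)
  show "rho_field M A u \<in> tangent_space M (fst u)" if "u \<in> points N" for u
    unfolding rho_field_def by (intro rho_tangent slit_vector_field_tangent assms that)
  show "smooth_on (chart_image N i) (\<lambda>z. fst (slit.rep A i z))" if "i \<in> indices M" for i
    by (intro smooth_on_bounded_linear_comp[OF bounded_linear_fst] open_slit_chart_image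
        smooth_on_slit_rep assms that)
  show "rho_field M A u i = fst (slit.rep A i (coord N i u))" if "i \<in> charts_at N u" for i u
    unfolding rho_field_def slit.chart_inv_coord[OF that]
    by (simp add: rho_eq[OF slit_vector_field_tangent[OF assms]] charts_atD(1)[OF that]
        del: slit_tangent_bundle_simps)
qed

end

section \<open>Regular connections on the pullback bundle\<close>

declare slit_tangent_bundle_simps(1,3,4) [simp del]

locale regular_pi_connection = slit_bundle M
  for M :: "('a, 'i, 'e::euclidean_space) charted_set" +
  fixes D :: "('a, 'i, 'e) pi_operator"
  assumes regular: "regular_connection M D"
begin

abbreviation K where "K \<equiv> curvature M D"

lemma linear_connection: "linear_connection M D"
  using regular by (simp add: regular_connection_def)

lemmas connection_rules = linear_connection[unfolded linear_connection_def Let_def]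

lemma D_cong:
  assumes "pi_vector_field M X" "\<And>u. u \<in> points N \<Longrightarrow> X u = Y u" "u \<in> points N"
    "A \<in> tangent_space N u"
  shows "D u A X = D u A Y"
  by (rule connection_rules[THEN conjunct1, rule_format]) (use assms in blast)+

lemma D_tangent:
  assumes "pi_vector_field M X" "u \<in> points N" "A \<in> tangent_space N u"
  shows "D u A X \<in> tangent_space M (fst u)"
  by (rule connection_rules[THEN conjunct2, THEN conjunct1, rule_format]) (use assms in blast)+

lemma D_add_left:
  assumes "pi_vector_field M X" "u \<in> points N" "A \<in> tangent_space N u" "B \<in> tangent_space N u"
  shows "D u (A + B) X = D u A X + D u B X"
  by (rule connection_rules[THEN conjunct2, THEN conjunct2, THEN conjunct1, rule_format]) (use assms in blast)+

lemma D_scaleR_left: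
  assumes "pi_vector_field M X" "u \<in> points N" "A \<in> tangent_space N u"
  shows "D u (c *\<^sub>R A) X = c *\<^sub>R D u A X"
  by (rule connection_rules[THEN conjunct2, THEN conjunct2, THEN conjunct2, THEN conjunct1, rule_format]) (use assms in blast)+

lemma D_add_right:
  assumes "pi_vector_field M X" "pi_vector_field M Y" "u \<in> points N" "A \<in> tangent_space N u"
  shows "D u A (X + Y) = D u A X + D u A Y"
  by (rule connection_rules[THEN conjunct2, THEN conjunct2, THEN conjunct2, THEN conjunct2, THEN conjunct1, rule_format]) (use assms in blast)+

lemma D_uminus_left:
  assumes "pi_vector_field M X" "u \<in> points N" "A \<in> tangent_space N u"
  shows "D u (- A) X = - D u A X"
  using D_scaleR_left[OF assms, of "-1"] by simp

lemma D_diff_left: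
  assumes "pi_vector_field M X" "u \<in> points N" "A \<in> tangent_space N u" "B \<in> tangent_space N u"
  shows "D u (A - B) X = D u A X - D u B X"
  using D_add_left[OF assms(1-3) slit.tangent_space_uminus[OF assms(4)]]
    D_uminus_left[OF assms(1,2,4)] by simp

lemma D_zero_left: "pi_vector_field M X \<Longrightarrow> u \<in> points N \<Longrightarrow> D u 0 X = 0"
  using D_scaleR_left[OF _ _ slit.tangent_space_zero, of X u 0] by simp

lemma D_zero_right: "u \<in> points N \<Longrightarrow> A \<in> tangent_space N u \<Longrightarrow> D u A 0 = 0"
  using D_add_right[OF pi_vector_field_zero pi_vector_field_zero, of u A] by simp

lemma D_uminus_right:
  assumes "pi_vector_field M X" "u \<in> points N" "A \<in> tangent_space N u"
  shows "D u A (- X) = - D u A X"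
  using D_add_right[OF assms(1) pi_vector_field_uminus[OF assms(1)] assms(2,3)]
    D_zero_right[OF assms(2,3)] by (simp add: eq_neg_iff_add_eq_0 add.commute)

text \<open>The one-form DX in a chart, as a family of linear maps in \<open>e\<close> indexed by
  the coordinates \<open>z\<close>. For fixed \<open>e\<close> it is the function whose smoothness
  the definition of a connection demands, and it takes the place of Christoffel symbols.\<close>

abbreviation conn_rep :: "('a, 'i, 'e) pi_section \<Rightarrow> 'i \<Rightarrow> 'e \<times> 'e \<Rightarrow> 'e \<times> 'e \<Rightarrow> 'e"
  where "conn_rep X i z e \<equiv> D (chart_inv N i z) (coord_vector N i (chart_inv N i z) e) X i"

lemma smooth_on_conn_rep:
  assumes "pi_vector_field M X" "i \<in> indices M"
  shows "smooth_on (chart_image N i) (\<lambda>z. conn_rep X i z e)"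
proof -
  have "i \<in> indices N" using assms(2) by simp
  then show ?thesis
    using connection_rules[THEN conjunct2, THEN conjunct2, THEN conjunct2, THEN conjunct2,
        THEN conjunct2, THEN conjunct2] assms(1) by blast
qed

lemma linear_conn_rep:
  assumes "pi_vector_field M X" "i \<in> indices M" "z \<in> chart_image N i"
  shows "linear (conn_rep X i z)"
proof (rule slit_chart_image_cases[OF assms(3,2)])
  fix u assume u: "i \<in> charts_at N u" "z = coord N i u" "chart_inv N i z = u"
  note cv = slit.coord_vector_in_tangent_space[OF u(1)]
  show ?thesis
    unfolding u(3)
  proof (rule linearI)
    fix a b and c :: real
    show "D u (coord_vector N i u (a + b)) X i =
        D u (coord_vector N i u a) X i + D u (coord_vector N i u b) X i"
      unfolding slit.coord_vector_add[OF u(1)] D_add_left[OF assms(1) charts_atD(1)[OF u(1)] cv cv]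
      by simp
    show "D u (coord_vector N i u (c *\<^sub>R a)) X i = c *\<^sub>R D u (coord_vector N i u a) X i"
      unfolding slit.coord_vector_scaleR[OF u(1)] D_scaleR_left[OF assms(1) charts_atD(1)[OF u(1)] cv]
      by (simp add: scaleR_fun_def)
  qed
qed

lemma conn_rep_coord:
  assumes "i \<in> charts_at N u" "A \<in> tangent_space N u"
  shows "conn_rep X i (coord N i u) (A i) = D u A X i"
  by (simp add: slit.chart_inv_coord[OF assms(1)] slit.coord_vector_component[OF assms(2,1)])

lemma pi_vector_field_cov:
  assumes "vector_field N A" "pi_vector_field M X"
  shows "pi_vector_field M (cov D A X)"
proof (rule pi_vector_fieldI)
  show "cov D A X u \<in> tangent_space M (fst u)" if "u \<in> points N" for u
    unfolding cov_def by (intro D_tangent assms that slit_vector_field_tangent)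
  show "smooth_on (chart_image N i) (\<lambda>z. conn_rep X i z (slit.rep A i z))" if "i \<in> indices M" for i
    by (rule smooth_on_apply_linear[OF open_slit_chart_image[OF that] linear_conn_rep[OF assms(2) that]
          smooth_on_conn_rep[OF assms(2) that] smooth_on_slit_rep[OF assms(1) that]])
  show "cov D A X u i = conn_rep X i (coord N i u) (slit.rep A i (coord N i u))"
    if "i \<in> charts_at N u" for i u
    using conn_rep_coord[OF that slit.vector_field_tangent[OF assms(1) that], of X]
    by (simp add: cov_def slit.chart_inv_coord[OF that])
qed

text \<open>The operator reads A at \<open>u\<close> only, whereas sections are identified by the
  connection only if they agree on the whole slit bundle.\<close>

lemma cov_cong:
  assumes "pi_vector_field M X" "\<And>u. u \<in> points N \<Longrightarrow> X u = X' u" "A u = A' u"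
    "vector_field N A" "u \<in> points N"
  shows "cov D A X u = cov D A' X' u"
  using D_cong[OF assms(1,2,5) slit_vector_field_tangent[OF assms(4,5)]] assms(3)
  by (simp add: cov_def)

lemma cov_cong_right:
  assumes "pi_vector_field M X" "\<And>u. u \<in> points N \<Longrightarrow> X u = X' u" "vector_field N A" "u \<in> points N"
  shows "cov D A X u = cov D A X' u"
  by (rule cov_cong[where A = A and A' = A, OF assms(1,2) refl assms(3,4)])

lemma cov_add_left:
  "vector_field N A \<Longrightarrow> vector_field N B \<Longrightarrow> pi_vector_field M X \<Longrightarrow> u \<in> points N \<Longrightarrow>
    cov D (A + B) X u = cov D A X u + cov D B X u"
  by (simp add: cov_def D_add_left slit_vector_field_tangent)

lemma cov_uminus_left:
  "vector_field N A \<Longrightarrow> pi_vector_field M X \<Longrightarrow> u \<in> points N \<Longrightarrow> cov D (- A) X u = - cov D A X u"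
  by (simp add: cov_def D_uminus_left slit_vector_field_tangent)

lemma cov_add_right:
  "vector_field N A \<Longrightarrow> pi_vector_field M X \<Longrightarrow> pi_vector_field M Y \<Longrightarrow> u \<in> points N \<Longrightarrow>
    cov D A (X + Y) u = cov D A X u + cov D A Y u"
  by (simp add: cov_def D_add_right slit_vector_field_tangent)

lemma cov_uminus_right:
  "vector_field N A \<Longrightarrow> pi_vector_field M X \<Longrightarrow> u \<in> points N \<Longrightarrow> cov D A (- X) u = - cov D A X u"
  by (simp add: cov_def D_uminus_right slit_vector_field_tangent)

lemma cov_diff_right:
  "vector_field N A \<Longrightarrow> pi_vector_field M X \<Longrightarrow> pi_vector_field M Y \<Longrightarrow> u \<in> points N \<Longrightarrow>
    cov D A (X - Y) u = cov D A X u - cov D A Y u"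
  using cov_add_right[of A X "- Y" u] by (simp add: cov_uminus_right pi_vector_field_uminus)

lemma cov_zero_right: "vector_field N A \<Longrightarrow> u \<in> points N \<Longrightarrow> cov D A 0 u = 0"
  by (simp add: cov_def D_zero_right slit_vector_field_tangent)

section \<open>Curvature and torsion of smooth fields\<close>

lemmas vector_field_bracket = slit.vector_field_lie_bracket

lemma pi_vector_field_curvature:
  "vector_field N A \<Longrightarrow> vector_field N B \<Longrightarrow> pi_vector_field M Z \<Longrightarrow> pi_vector_field M (K A B Z)"
  unfolding curvature_def
  by (intro pi_vector_field_add pi_vector_field_uminus pi_vector_field_cov vector_field_bracket)

lemma pi_vector_field_torsion:
  "vector_field N A \<Longrightarrow> vector_field N B \<Longrightarrow> pi_vector_field M (torsion M D A B)"
  unfolding torsion_def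
  by (intro pi_vector_field_diff pi_vector_field_cov pi_vector_field_rho vector_field_bracket)

text \<open>Agreement of A and B at \<open>u\<close> alone would not do here, as the bracket and the
  inner covariant derivatives differentiate them.\<close>

lemma curvature_cong:
  assumes "pi_vector_field M Z" "vector_field N A" "vector_field N B"
    "\<And>u. u \<in> points N \<Longrightarrow> A u = A' u" "\<And>u. u \<in> points N \<Longrightarrow> B u = B' u" "u \<in> points N"
  shows "K A B Z u = K A' B' Z u"
proof -
  have A: "cov D A Z u = cov D A' Z u" and B: "cov D B Z u = cov D B' Z u" if "u \<in> points N" for u
    using assms(4,5)[OF that] by (simp_all add: cov_def)
  have "cov D A (cov D B Z) u = cov D A' (cov D B' Z) u"
    by (rule cov_cong[OF pi_vector_field_cov[OF assms(3,1)] B]) (use assms in auto)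
  moreover have "cov D B (cov D A Z) u = cov D B' (cov D A' Z) u"
    by (rule cov_cong[OF pi_vector_field_cov[OF assms(2,1)] A]) (use assms in auto)
  moreover have "lie_bracket N A B u = lie_bracket N A' B' u"
    by (rule slit.lie_bracket_cong[OF assms(4,5,6)])
  ultimately show ?thesis by (simp add: curvature_def cov_def)
qed

lemma curvature_antisym:
  assumes "pi_vector_field M Z" "vector_field N A" "vector_field N B" "u \<in> points N"
  shows "K A B Z u = - K B A Z u"
  using assms cov_uminus_left[OF vector_field_bracket[OF assms(2,3)] assms(1,4)]
  by (simp add: curvature_def slit.lie_bracket_antisym[of B A])

lemma curvature_add_left:
  assumes "pi_vector_field M Z" "vector_field N A" "vector_field N A'" "vector_field N B" "u \<in> points N"
  shows "K (A + A') B Z u = K A B Z u + K A' B Z u"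
proof -
  have "cov D B (cov D (A + A') Z) u = cov D B (cov D A Z + cov D A' Z) u"
    using assms by (intro cov_cong) (auto simp: cov_add_left intro!: pi_vector_field_cov slit.vector_field_add)
  moreover have "cov D (lie_bracket N (A + A') B) Z u =
      cov D (lie_bracket N A B + lie_bracket N A' B) Z u"
    by (simp add: cov_def slit.lie_bracket_add_left assms)
  ultimately show ?thesis
    using assms by (simp add: curvature_def cov_add_left cov_add_right pi_vector_field_cov
        vector_field_bracket)
qed

lemma curvature_uminus_left:
  assumes "pi_vector_field M Z" "vector_field N A" "vector_field N B" "u \<in> points N"
  shows "K (- A) B Z u = - K A B Z u"
proof -
  have vf: "vector_field N (0 :: ('a, 'i, 'e) slit_field)"
    using slit.vector_field_add[OF assms(2) slit.vector_field_uminus[OF assms(2)]] by simp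
  have "K 0 B Z u = 0" using curvature_add_left[OF assms(1) vf vf assms(3,4)] by simp
  then show ?thesis
    using curvature_add_left[OF assms(1,2) slit.vector_field_uminus[OF assms(2)] assms(3,4)]
    by (simp add: eq_neg_iff_add_eq_0 add.commute)
qed

text \<open>After expansion the threefold derivatives of W are the same on both sides. On the right,
  derivatives along a bracket of D_A W cancel, and the terms D_C D_[A,B] W match those on the left.
  What remains is the derivative of W along the cyclic sum of double brackets.\<close>

lemma second_bianchi:
  assumes "vector_field N A" "vector_field N B" "vector_field N C" "pi_vector_field M W" "u \<in> points N"
  shows "cov D A (K B C W) u + cov D B (K C A W) u + cov D C (K A B W) u =
    K B C (cov D A W) u + K C A (cov D B W) u + K A B (cov D C W) u +
    K (lie_bracket N A B) C W u + K (lie_bracket N B C) A W u + K (lie_bracket N C A) B W u"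
proof -
  note closed = assms pi_vector_field_cov vector_field_bracket pi_vector_field_add
    pi_vector_field_uminus pi_vector_field_diff
  have "cov D (lie_bracket N (lie_bracket N A B) C) W u + cov D (lie_bracket N (lie_bracket N B C) A) W u +
      cov D (lie_bracket N (lie_bracket N C A) B) W u =
      D u (lie_bracket N (lie_bracket N A B) C u + lie_bracket N (lie_bracket N B C) A u +
      lie_bracket N (lie_bracket N C A) B u) W"
    by (simp add: cov_def D_add_left slit.tangent_space_add slit.lie_bracket_tangent closed)
  also have "\<dots> = 0"
    using slit.lie_bracket_jacobi[OF assms(1-3), of u] by (simp add: D_zero_left closed)
  \<comment> \<open>Solved for one of the three terms, Jacobi's identity becomes a rewrite
    rule.\<close>
  finally have jacobi: "cov D (lie_bracket N (lie_bracket N C A) B) W u =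
      - cov D (lie_bracket N (lie_bracket N A B) C) W u - cov D (lie_bracket N (lie_bracket N B C) A) W u"
    by (simp add: eq_neg_iff_add_eq_0 algebra_simps)
  show ?thesis
    unfolding curvature_def
    by (simp add: cov_add_right cov_diff_right closed jacobi algebra_simps)
qed

section \<open>Horizontal lifts and their smoothness\<close>

lemma vertical_horizontal_eq_zero:
  assumes "u \<in> points N" "A \<in> tangent_space N u" "rho M u A = 0" "D u A eta = 0"
  shows "A = 0"
proof -
  have "A \<in> vertical_space M u \<inter> horizontal_space M D u"
    using assms by (simp add: vertical_space_def horizontal_space_def deflection_def)
  moreover have "vertical_space M u \<inter> horizontal_space M D u = {0}"
    using regular assms(1) unfolding regular_connection_def by blast
  ultimately show ?thesis by simp
qed

lemma rho_diff:
  assumes "u \<in> points N" "A \<in> tangent_space N u" "B \<in> tangent_space N u"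
  shows "rho M u (A - B) = rho M u A - rho M u B"
  by (simp add: rho_eq assms slit.tangent_space_diff fun_eq_iff)

lemma rho_add:
  assumes "u \<in> points N" "A \<in> tangent_space N u" "B \<in> tangent_space N u"
  shows "rho M u (A + B) = rho M u A + rho M u B"
  by (simp add: rho_eq assms slit.tangent_space_add fun_eq_iff)

text \<open>The kernel of the pair (\<rho>, D\<eta>) is the intersection of V and H, which
  regularity makes trivial. Both the horizontal lift and the decomposition of a field are identified
  by these two values.\<close>

lemma slit_tangent_eqI:
  assumes "u \<in> points N" "A \<in> tangent_space N u" "B \<in> tangent_space N u"
    "rho M u A = rho M u B" "D u A eta = D u B eta"
  shows "A = B"
  using vertical_horizontal_eq_zero[OF assms(1) slit.tangent_space_diff[OF assms(2,3)]]
    rho_diff[OF assms(1-3)] D_diff_left[OF pi_vector_field_eta assms(1-3)] assms(4,5) by simp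

lemma horizontal_lift_eqI:
  assumes "u \<in> points N" "A \<in> tangent_space N u" "rho M u A = w" "D u A eta = 0"
  shows "horizontal_lift M D u w = A"
  unfolding horizontal_lift_def
proof (rule the_inv_into_f_eq[where f = "rho M u" and x = A, OF _ assms(3)])
  show "A \<in> horizontal_space M D u" using assms by (simp add: horizontal_space_def deflection_def)
  show "inj_on (rho M u) (horizontal_space M D u)"
    by (rule inj_onI) (auto simp: horizontal_space_def deflection_def intro: slit_tangent_eqI[OF assms(1)])
qed

lemma linear_conn_rep_eta_vertical:
  assumes "i \<in> indices M" "z \<in> chart_image N i"
  shows "linear (\<lambda>b. conn_rep eta i z (0, b))"
proof -
  note lin = linear_conn_rep[OF pi_vector_field_eta assms]
  show ?thesis
    using linear_add[OF lin, of "(0, _)" "(0, _)"] linear_scale[OF lin, of _ "(0, _)"]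
    by (auto intro: linearI)
qed

text \<open>Since \<open>V \<inter> H = 0\<close>, the endomorphism \<open>b \<mapsto> D\<^bsub>\<gamma>b\<^esub>\<eta>\<close> of the fibre is injective, hence invertible; its
  inverse yields the vertical part of the horizontal lift in coordinates.\<close>

lemma inj_conn_rep_eta:
  assumes "i \<in> indices M" "z \<in> chart_image N i"
  shows "inj (\<lambda>b. conn_rep eta i z (0, b))"
proof (rule slit_chart_image_cases[OF assms(2,1)])
  fix u assume u: "i \<in> charts_at N u" "z = coord N i u" "chart_inv N i z = u"
  note lin = linear_conn_rep_eta_vertical[OF assms]
  show ?thesis
    unfolding linear_injective_0[OF lin]
  proof (intro allI impI)
    fix b assume b: "conn_rep eta i z (0, b) = 0"
    let ?A = "coord_vector N i u (0, b)"
    note A = slit.coord_vector_in_tangent_space[OF u(1)] and up = charts_atD[OF u(1)]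
    have Ai: "?A i = (0, b)" by (rule slit.coord_vector_same[OF u(1)])
    have "rho M u ?A = 0"
      by (rule tangent_space_eqI[OF rho_tangent[OF A up(1)] tangent_space_zero up(2)])
        (simp add: rho_eq[OF A up(1)] Ai)
    moreover have "D u ?A eta = 0"
      using b by (intro tangent_space_eqI[OF D_tangent[OF pi_vector_field_eta up(1) A]
            tangent_space_zero up(2)]) (simp add: u(3))
    ultimately have "?A = 0" by (rule vertical_horizontal_eq_zero[OF up(1) A])
    then have "?A i = 0" by (simp only: zero_fun_apply)
    then show "b = 0" using Ai by (simp add: zero_prod_def)
  qed
qed

text \<open>The solution (a, b) of k(a, b) = 0 with given a, where k is D\<eta> in the chart: by
  linearity k(0, b) = -k(a, 0), to be solved for b.\<close>

abbreviation horizontal_rep :: "'i \<Rightarrow> 'e \<times> 'e \<Rightarrow> 'e \<Rightarrow> 'e \<times> 'e"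
  where "horizontal_rep i z a \<equiv>
    (a, - inv (\<lambda>b. conn_rep eta i z (0, b)) (conn_rep eta i z (a, 0)))"

lemma horizontal_rep:
  assumes "i \<in> charts_at N u" "w \<in> tangent_space M (fst u)"
  defines "A \<equiv> coord_vector N i u (horizontal_rep i (coord N i u) (w i))"
  shows "A \<in> tangent_space N u" "rho M u A = w" "D u A eta = 0"
proof -
  note up = charts_atD[OF assms(1)]
  have i: "i \<in> indices M" using up(2) by (simp add: charts_at_iff)
  note z = slit.coord_in_chart_image[OF assms(1)]
  have u: "u \<in> points N" by (rule up)
  show A: "A \<in> tangent_space N u"
    unfolding A_def by (rule slit.coord_vector_in_tangent_space[OF assms(1)])
  have Ai: "A i = horizontal_rep i (coord N i u) (w i)"
    unfolding A_def by (rule slit.coord_vector_same[OF assms(1)])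
  show "rho M u A = w"
    by (rule tangent_space_eqI[OF rho_tangent[OF A u] assms(2) up(2)]) (simp add: rho_eq[OF A u] Ai)
  let ?k = "conn_rep eta i (coord N i u)"
  have lin: "linear ?k" by (rule linear_conn_rep[OF pi_vector_field_eta i z])
  \<comment> \<open>An injective endomorphism of a finite-dimensional space is surjective, so the
    vertical part can cancel k(a, 0).\<close>
  have surj: "?k (0, inv (\<lambda>b. ?k (0, b)) c) = c" for c
    using linear_inj_imp_surj[OF linear_conn_rep_eta_vertical[OF i z] inj_conn_rep_eta[OF i z]]
    by (rule surj_f_inv_f)
  have "?k (a, - b) = ?k (a, 0) - ?k (0, b)" for a b
    using linear_diff[OF lin, of "(a, 0)" "(0, b)"] by simp
  then have "?k (A i) = 0" unfolding Ai using surj by simp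
  then show "D u A eta = 0"
    unfolding conn_rep_coord[OF assms(1) A]
    by (intro tangent_space_eqI[OF D_tangent[OF pi_vector_field_eta u A] tangent_space_zero up(2)]) simp
qed

lemma horizontal_lift_eq:
  assumes "i \<in> charts_at N u" "w \<in> tangent_space M (fst u)"
  shows "horizontal_lift M D u w = coord_vector N i u (horizontal_rep i (coord N i u) (w i))"
  by (rule horizontal_lift_eqI[OF charts_atD(1)[OF assms(1)] horizontal_rep[OF assms]])

lemma horizontal_lift:
  assumes "u \<in> points N" "w \<in> tangent_space M (fst u)"
  shows "horizontal_lift M D u w \<in> tangent_space N u"
    and "rho M u (horizontal_lift M D u w) = w"
    and "D u (horizontal_lift M D u w) eta = 0"
proof -
  obtain i where i: "i \<in> charts_at N u" using obtain_chart[OF assms(1)] .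
  note lift = horizontal_rep[OF i assms(2), folded horizontal_lift_eq[OF i assms(2)]]
  from lift(1) show "horizontal_lift M D u w \<in> tangent_space N u" .
  from lift(2) show "rho M u (horizontal_lift M D u w) = w" .
  from lift(3) show "D u (horizontal_lift M D u w) eta = 0" .
qed

text \<open>Two smooth families are composed: D\<eta> evaluated on (X, 0), and the inverse of its
  restriction to vertical vectors evaluated on the result.\<close>

lemma vector_field_beta:
  assumes "pi_vector_field M X"
  shows "vector_field N (beta_field M D X)"
proof (rule slit_vector_fieldI)
  show "beta_field M D X u \<in> tangent_space N u" if "u \<in> points N" for u
    unfolding beta_field_def by (intro horizontal_lift that pi_vector_field_tangent assms)
  show "smooth_on (chart_image N i) (\<lambda>z. horizontal_rep i z (X (chart_inv N i z) i))"
    if i: "i \<in> indices M" for i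
  proof -
    note S = open_slit_chart_image[OF i]
    note X = smooth_on_pi_rep[OF assms i]
    have "smooth_on (chart_image N i) (\<lambda>z. conn_rep eta i z (X (chart_inv N i z) i, 0))"
      by (rule smooth_on_apply_linear[OF S linear_conn_rep[OF pi_vector_field_eta i]
            smooth_on_conn_rep[OF pi_vector_field_eta i] smooth_on_Pair[OF S X smooth_on_const]])
    moreover have "linear (inv (\<lambda>b. conn_rep eta i z (0, b)))" if "z \<in> chart_image N i" for z
      by (rule inj_linear_imp_inv_linear[OF linear_conn_rep_eta_vertical[OF i that]
            inj_conn_rep_eta[OF i that]])
    moreover have "smooth_on (chart_image N i) (\<lambda>z. inv (\<lambda>b. conn_rep eta i z (0, b)) v)" for v
      by (rule smooth_on_inv_linear_family[OF S linear_conn_rep_eta_vertical[OF i]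
            inj_conn_rep_eta[OF i] smooth_on_conn_rep[OF pi_vector_field_eta i]])
    ultimately have "smooth_on (chart_image N i) (\<lambda>z. inv (\<lambda>b. conn_rep eta i z (0, b))
        (conn_rep eta i z (X (chart_inv N i z) i, 0)))"
      by (rule smooth_on_apply_linear[OF S, where
            L = "\<lambda>z. inv (\<lambda>b. conn_rep eta i z (0, b))", rotated 2])
    then show ?thesis by (intro smooth_on_Pair[OF S X] smooth_on_uminus[OF S])
  qed
  show "beta_field M D X u i = horizontal_rep i (coord N i u) (X (chart_inv N i (coord N i u)) i)"
    if i: "i \<in> charts_at N u" for i u
    unfolding beta_field_def slit.chart_inv_coord[OF i]
      horizontal_lift_eq[OF i pi_vector_field_tangent[OF assms charts_atD(1)[OF i]]]
      slit.coord_vector_same[OF i] ..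
qed

end

context regular_pi_connection
begin

abbreviation \<gamma> where "\<gamma> \<equiv> gamma_field M"
abbreviation \<beta> where "\<beta> \<equiv> beta_field M D"

section \<open>Vertical and horizontal fields and the projections of their brackets\<close>

lemma rho_gamma:
  assumes "pi_vector_field M X" "u \<in> points N"
  shows "rho_field M (\<gamma> X) u = 0"
  unfolding rho_field_def rho_eq[OF slit_vector_field_tangent[OF vector_field_gamma[OF assms(1)] assms(2)] assms(2)]
  by (simp add: gamma_field_def vertical_lift_eq pi_vector_field_tangent assms fun_eq_iff)

lemma rho_beta: "pi_vector_field M X \<Longrightarrow> u \<in> points N \<Longrightarrow> rho_field M (\<beta> X) u = X u"
  by (simp add: rho_field_def beta_field_def horizontal_lift pi_vector_field_tangent)

lemma cov_beta_eta: "pi_vector_field M X \<Longrightarrow> u \<in> points N \<Longrightarrow> cov D (\<beta> X) eta u = 0"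
  by (simp add: cov_def beta_field_def horizontal_lift pi_vector_field_tangent)

lemma gamma_component:
  assumes "pi_vector_field M X" "i \<in> charts_at N u"
  shows "\<gamma> X u i = (0, X u i)"
  by (simp add: gamma_field_def vertical_lift_eq pi_vector_field_tangent assms charts_atD(1)[OF assms(2)])

lemma rho_field_component:
  assumes "vector_field N A" "i \<in> charts_at N u"
  shows "rho_field M A u i = fst (A u i)"
  by (simp add: rho_field_def rho_eq slit_vector_field_tangent assms charts_atD(1)[OF assms(2)])

text \<open>The first component of \<gamma>X vanishes identically, so of the two terms of the
  bracket only the derivative of the first component of A along \<gamma>X = (0, X)
  contributes.\<close>

lemma rho_lie_bracket_gamma:
  assumes "pi_vector_field M X" "vector_field N A" "i \<in> charts_at N u"
  shows "rho_field M (lie_bracket N (\<gamma> X) A) u i =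
    frechet_derivative (\<lambda>z. rho_field M A (chart_inv N i z) i) (at (coord N i u)) (0, X u i)"
proof -
  have i: "i \<in> indices M" "i \<in> indices N" using assms(3) by (auto simp: slit.charts_at_iff)
  note S = open_slit_chart_image[OF i(1)] slit.coord_in_chart_image[OF assms(3)]
  note vX = vector_field_gamma[OF assms(1)]
  have fst_derivative: "fst (frechet_derivative (slit.rep B i) (at (coord N i u)) w) =
      frechet_derivative (\<lambda>z. rho_field M B (chart_inv N i z) i) (at (coord N i u)) w"
    if "vector_field N B" for B w
  proof -
    have "frechet_derivative (\<lambda>z. fst (slit.rep B i z)) (at (coord N i u)) =
        (\<lambda>w. fst (frechet_derivative (slit.rep B i) (at (coord N i u)) w))"
      by (rule frechet_derivative_bounded_linear_comp[OF bounded_linear_fst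
            differentiableI[OF slit.has_derivative_rep[OF that assms(3)]]])
    moreover have "frechet_derivative (\<lambda>z. fst (slit.rep B i z)) (at (coord N i u)) =
        frechet_derivative (\<lambda>z. rho_field M B (chart_inv N i z) i) (at (coord N i u))"
    proof (rule frechet_derivative_cong_open[OF S])
      fix z assume "z \<in> chart_image N i"
      then show "fst (slit.rep B i z) = rho_field M B (chart_inv N i z) i"
        by (rule slit_chart_image_cases[OF _ i(1)]) (simp add: rho_field_component[OF that])
    qed
    ultimately show ?thesis by simp
  qed
  have "frechet_derivative (\<lambda>z. rho_field M (\<gamma> X) (chart_inv N i z) i) (at (coord N i u)) =
      frechet_derivative (\<lambda>z. 0) (at (coord N i u))"
  proof (rule frechet_derivative_cong_open[OF S])
    fix z assume "z \<in> chart_image N i"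
    then show "rho_field M (\<gamma> X) (chart_inv N i z) i = 0"
      by (rule slit_chart_image_cases[OF _ i(1)]) (simp add: rho_gamma[OF assms(1)] charts_atD(1))
  qed
  then show ?thesis
    by (simp add: rho_field_component[OF vector_field_bracket[OF vX assms(2)] assms(3)]
        slit.lie_bracket_component[OF assms(3)] fst_derivative[OF vX] fst_derivative[OF assms(2)]
        gamma_component[OF assms(1,3)])
qed

text \<open>The vertical bundle is involutive: now both fields have vanishing first
  component.\<close>

lemma rho_lie_bracket_gamma_gamma:
  assumes "pi_vector_field M X" "pi_vector_field M Y" "u \<in> points N"
  shows "rho_field M (lie_bracket N (\<gamma> X) (\<gamma> Y)) u = 0"
proof -
  obtain i where i: "i \<in> charts_at N u" using obtain_chart[OF assms(3)] .
  note v = vector_field_gamma[OF assms(1)] vector_field_gamma[OF assms(2)]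
  have ind: "i \<in> indices M" using i by (auto simp: slit.charts_at_iff)
  have "frechet_derivative (\<lambda>z. rho_field M (\<gamma> Y) (chart_inv N i z) i) (at (coord N i u)) =
      frechet_derivative (\<lambda>z. 0) (at (coord N i u))"
  proof (rule frechet_derivative_cong_open[OF open_slit_chart_image[OF ind] slit.coord_in_chart_image[OF i]])
    fix z assume "z \<in> chart_image N i"
    then show "rho_field M (\<gamma> Y) (chart_inv N i z) i = 0"
      by (rule slit_chart_image_cases[OF _ ind]) (simp add: rho_gamma[OF assms(2)] charts_atD(1))
  qed
  then have "rho_field M (lie_bracket N (\<gamma> X) (\<gamma> Y)) u i = 0"
    by (simp add: rho_lie_bracket_gamma[OF assms(1) v(2) i])
  then show ?thesis
    by (intro tangent_space_eqI[OF pi_vector_field_tangent[OF pi_vector_field_rho[OF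
          vector_field_bracket[OF v]] assms(3)] tangent_space_zero charts_atD(2)[OF i]]) simp
qed

text \<open>\<open>\<beta>\<eta>\<close> is a semispray: in coordinates \<open>(x, y)\<close> its first component is \<open>y\<close>.\<close>

lemma rho_lie_bracket_gamma_semispray:
  assumes "pi_vector_field M X" "u \<in> points N"
  shows "rho_field M (lie_bracket N (\<gamma> X) (\<beta> eta)) u = X u"
proof -
  obtain i where i: "i \<in> charts_at N u" using obtain_chart[OF assms(2)] .
  note v = vector_field_gamma[OF assms(1)] vector_field_beta[OF pi_vector_field_eta]
  have ind: "i \<in> indices M" using i by (auto simp: slit.charts_at_iff)
  have "frechet_derivative (\<lambda>z. rho_field M (\<beta> eta) (chart_inv N i z) i) (at (coord N i u)) =
      frechet_derivative snd (at (coord N i u))"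
  proof (rule frechet_derivative_cong_open[OF open_slit_chart_image[OF ind] slit.coord_in_chart_image[OF i]])
    fix z assume "z \<in> chart_image N i"
    then show "rho_field M (\<beta> eta) (chart_inv N i z) i = snd z"
      by (rule slit_chart_image_cases[OF _ ind])
        (simp add: rho_beta[OF pi_vector_field_eta] charts_atD(1) eta_def slit_tangent_bundle_simps(4))
  qed
  also have "\<dots> = snd"
    by (rule frechet_derivative_at[symmetric])
      (rule bounded_linear_imp_has_derivative[OF bounded_linear_snd])
  finally have "rho_field M (lie_bracket N (\<gamma> X) (\<beta> eta)) u i = X u i"
    by (simp add: rho_lie_bracket_gamma[OF assms(1) v(2) i])
  then show ?thesis
    by (rule tangent_space_eqI[OF pi_vector_field_tangent[OF pi_vector_field_rho[OF
          vector_field_bracket[OF v]] assms(2)] pi_vector_field_tangent[OF assms] charts_atD(2)[OF i]])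
qed

lemma gamma_add:
  assumes "pi_vector_field M X" "pi_vector_field M Y" "u \<in> points N"
  shows "\<gamma> (X + Y) u = (\<gamma> X + \<gamma> Y) u"
  by (simp add: gamma_field_def vertical_lift_eq pi_vector_field_tangent tangent_space_add assms fun_eq_iff)

text \<open>The sum of the two lifts is horizontal and has the right projection, which characterises
  the lift of the sum.\<close>

lemma beta_add:
  assumes "pi_vector_field M X" "pi_vector_field M Y" "u \<in> points N"
  shows "\<beta> (X + Y) u = (\<beta> X + \<beta> Y) u"
proof -
  note lift = horizontal_lift[OF assms(3) pi_vector_field_tangent[OF assms(1,3)]]
    horizontal_lift[OF assms(3) pi_vector_field_tangent[OF assms(2,3)]]
  have "horizontal_lift M D u (X u + Y u) = horizontal_lift M D u (X u) + horizontal_lift M D u (Y u)"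
    by (rule horizontal_lift_eqI[OF assms(3)])
      (simp_all add: slit.tangent_space_add rho_add D_add_left pi_vector_field_eta assms lift)
  then show ?thesis by (simp add: beta_field_def)
qed

lemma curvature_gamma_add:
  assumes "pi_vector_field M X" "pi_vector_field M Y" "vector_field N C" "pi_vector_field M W" "u \<in> points N"
  shows "K (\<gamma> (X + Y)) C W u = K (\<gamma> X) C W u + K (\<gamma> Y) C W u"
  using curvature_cong[OF assms(4) vector_field_gamma[OF pi_vector_field_add[OF assms(1,2)]] assms(3)
      gamma_add[OF assms(1,2)] refl assms(5)]
    curvature_add_left[OF assms(4) vector_field_gamma[OF assms(1)] vector_field_gamma[OF assms(2)] assms(3,5)]
  by (rule trans)

lemma curvature_beta_add:
  assumes "pi_vector_field M X" "pi_vector_field M Y" "vector_field N C" "pi_vector_field M W" "u \<in> points N"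
  shows "K (\<beta> (X + Y)) C W u = K (\<beta> X) C W u + K (\<beta> Y) C W u"
  using curvature_cong[OF assms(4) vector_field_beta[OF pi_vector_field_add[OF assms(1,2)]] assms(3)
      beta_add[OF assms(1,2)] refl assms(5)]
    curvature_add_left[OF assms(4) vector_field_beta[OF assms(1)] vector_field_beta[OF assms(2)] assms(3,5)]
  by (rule trans)

lemma curvature_gamma_diff:
  assumes "pi_vector_field M X" "pi_vector_field M Y" "vector_field N C" "pi_vector_field M W" "u \<in> points N"
  shows "K (\<gamma> (X - Y)) C W u = K (\<gamma> X) C W u - K (\<gamma> Y) C W u"
  using curvature_gamma_add[OF pi_vector_field_diff[OF assms(1,2)] assms(2-5)] by simp

lemma curvature_beta_diff:
  assumes "pi_vector_field M X" "pi_vector_field M Y" "vector_field N C" "pi_vector_field M W" "u \<in> points N"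
  shows "K (\<beta> (X - Y)) C W u = K (\<beta> X) C W u - K (\<beta> Y) C W u"
  using curvature_beta_add[OF pi_vector_field_diff[OF assms(1,2)] assms(2-5)] by simp

end

section \<open>Bianchi identities\<close>

locale eta_torsion_free_connection = regular_pi_connection M D
  for M :: "('a, 'i, 'e::euclidean_space) charted_set" and D :: "('a, 'i, 'e) pi_operator" +
  assumes hv_torsion_eta:
    "\<And>X u. pi_vector_field M X \<Longrightarrow> u \<in> points (slit_tangent_bundle M) \<Longrightarrow> hv_torsion M D X eta u = 0"
begin

lemma cov_gamma_eta:
  assumes "pi_vector_field M X" "u \<in> points N"
  shows "cov D (\<gamma> X) eta u = X u"
proof -
  note v = vector_field_gamma[OF assms(1)] vector_field_beta[OF pi_vector_field_eta]
  have "cov D (\<gamma> X) (rho_field M (\<beta> eta)) u = cov D (\<gamma> X) eta u"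
    by (rule cov_cong_right[OF pi_vector_field_rho[OF v(2)] rho_beta[OF pi_vector_field_eta] v(1) assms(2)])
  moreover have "cov D (\<beta> eta) (rho_field M (\<gamma> X)) u = cov D (\<beta> eta) 0 u"
    by (rule cov_cong_right[OF pi_vector_field_rho[OF v(1)] _ v(2) assms(2)])
      (simp add: rho_gamma[OF assms(1)])
  ultimately show ?thesis
    using hv_torsion_eta[OF assms] rho_lie_bracket_gamma_semispray[OF assms]
      cov_zero_right[OF v(2) assms(2)]
    by (simp add: hv_torsion_def torsion_def)
qed

text \<open>Both sides have the same \<rho> and the same D\<eta>. For a general regular connection
  the vertical part would be \<gamma> of the preimage of D_A \<eta> under X -> D\<eta>(\<gamma>X);
  here this endomorphism is the identity.\<close>

lemma decomposition:
  assumes "vector_field N A" "u \<in> points N"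
  shows "A u = (\<gamma> (cov D A eta) + \<beta> (rho_field M A)) u"
proof (rule slit_tangent_eqI[OF assms(2) slit_vector_field_tangent[OF assms]])
  note p = pi_vector_field_cov[OF assms(1) pi_vector_field_eta] pi_vector_field_rho[OF assms(1)]
  note v = vector_field_gamma[OF p(1)] vector_field_beta[OF p(2)]
  note t = slit_vector_field_tangent[OF v(1) assms(2)] slit_vector_field_tangent[OF v(2) assms(2)]
  show "(\<gamma> (cov D A eta) + \<beta> (rho_field M A)) u \<in> tangent_space N u"
    using slit.tangent_space_add[OF t] by simp
  show "rho M u (A u) = rho M u ((\<gamma> (cov D A eta) + \<beta> (rho_field M A)) u)"
  proof -
    have "rho M u (B u) = rho_field M B u" for B by (simp add: rho_field_def)
    then show ?thesis
      using rho_gamma[OF p(1) assms(2)] rho_beta[OF p(2) assms(2)]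
      by (simp only: plus_fun_apply rho_add[OF assms(2) t] add_0_left)
  qed
  show "D u (A u) eta = D u ((\<gamma> (cov D A eta) + \<beta> (rho_field M A)) u) eta"
  proof -
    have "D u (B u) eta = cov D B eta u" for B by (simp add: cov_def)
    then show ?thesis
      using cov_gamma_eta[OF p(1) assms(2)] cov_beta_eta[OF p(2) assms(2)]
      by (simp only: plus_fun_apply D_add_left[OF pi_vector_field_eta assms(2) t] add_0_right)
  qed
qed

text \<open>The sections \<open>a\<close> and \<open>r\<close> can be explicit sums and differences,
  ready to be split by additivity. They must agree with the two parts of A at all points, because
  curvature differentiates its arguments.\<close>

lemma curvature_decomposition:
  assumes "vector_field N A" "vector_field N C" "pi_vector_field M W" "u \<in> points N"
    and a: "pi_vector_field M a" "\<And>u. u \<in> points N \<Longrightarrow> cov D A eta u = a u"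
    and r: "pi_vector_field M r" "\<And>u. u \<in> points N \<Longrightarrow> rho_field M A u = r u"
  shows "K A C W u = K (\<gamma> a) C W u + K (\<beta> r) C W u"
proof -
  note v = vector_field_gamma[OF a(1)] vector_field_beta[OF r(1)]
  have "A u = (\<gamma> a + \<beta> r) u" if "u \<in> points N" for u
    using decomposition[OF assms(1) that] a(2)[OF that] r(2)[OF that]
    by (simp add: gamma_field_def beta_field_def)
  then have "K A C W u = K (\<gamma> a + \<beta> r) C W u"
    by (intro curvature_cong assms refl)
  then show ?thesis using curvature_add_left[OF assms(3) v assms(2,4)] by simp
qed

text \<open>The definition of curvature on \<eta>, solved for its bracket term; the sign convention
  gives K a positive sign.\<close>

lemma cov_lie_bracket_eta:
  assumes "pi_vector_field M a" "\<And>u. u \<in> points N \<Longrightarrow> cov D A eta u = a u"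
    and "pi_vector_field M b" "\<And>u. u \<in> points N \<Longrightarrow> cov D B eta u = b u"
    and "vector_field N A" "vector_field N B" "u \<in> points N"
  shows "cov D (lie_bracket N A B) eta u = (K A B eta + cov D A b - cov D B a) u"
proof -
  have "cov D A (cov D B eta) u = cov D A b u"
    by (rule cov_cong_right[OF pi_vector_field_cov[OF assms(6) pi_vector_field_eta] assms(4) assms(5,7)])
  moreover have "cov D B (cov D A eta) u = cov D B a u"
    by (rule cov_cong_right[OF pi_vector_field_cov[OF assms(5) pi_vector_field_eta] assms(2) assms(6,7)])
  ultimately show ?thesis by (simp add: curvature_def)
qed

text \<open>The definition of torsion, solved for its bracket term.\<close>

lemma rho_lie_bracket:
  assumes "pi_vector_field M a" "\<And>u. u \<in> points N \<Longrightarrow> rho_field M A u = a u"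
    and "pi_vector_field M b" "\<And>u. u \<in> points N \<Longrightarrow> rho_field M B u = b u"
    and "vector_field N A" "vector_field N B" "u \<in> points N"
  shows "rho_field M (lie_bracket N A B) u = (cov D A b - cov D B a - torsion M D A B) u"
proof -
  have "cov D A (rho_field M B) u = cov D A b u"
    by (rule cov_cong_right[OF pi_vector_field_rho[OF assms(6)] assms(4) assms(5,7)])
  moreover have "cov D B (rho_field M A) u = cov D B a u"
    by (rule cov_cong_right[OF pi_vector_field_rho[OF assms(5)] assms(2) assms(6,7)])
  ultimately show ?thesis by (simp add: torsion_def)
qed

section \<open>Curvature with a bracket as its first argument\<close>

lemmas closed = pi_vector_field_cov vector_field_bracket pi_vector_field_add pi_vector_field_diff
  pi_vector_field_eta pi_vector_field_zero pi_vector_field_curvature pi_vector_field_torsion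
  vector_field_gamma vector_field_beta

lemma curvature_beta_zero:
  assumes "vector_field N C" "pi_vector_field M W" "u \<in> points N"
  shows "K (\<beta> 0) C W u = 0"
  using curvature_beta_diff[OF pi_vector_field_zero pi_vector_field_zero assms] by simp

text \<open>The bracket is vertical, so its horizontal section is 0. The vertical one is
  \<open>hat\<close> of S plus D_{\<gamma>X}Y - D_{\<gamma>Y}X.\<close>

lemma curvature_lie_bracket_gamma_gamma:
  assumes "pi_vector_field M X" "pi_vector_field M Y" "vector_field N C" "pi_vector_field M W" "u \<in> points N"
  shows "K (lie_bracket N (\<gamma> X) (\<gamma> Y)) C W u =
    K (\<gamma> (K (\<gamma> X) (\<gamma> Y) eta)) C W u + K (\<gamma> (cov D (\<gamma> X) Y)) C W u - K (\<gamma> (cov D (\<gamma> Y) X)) C W u"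
proof -
  have "K (lie_bracket N (\<gamma> X) (\<gamma> Y)) C W u =
      K (\<gamma> (K (\<gamma> X) (\<gamma> Y) eta + cov D (\<gamma> X) Y - cov D (\<gamma> Y) X)) C W u + K (\<beta> 0) C W u"
    using assms
    by (intro curvature_decomposition cov_lie_bracket_eta)
      (simp_all add: closed cov_gamma_eta rho_lie_bracket_gamma_gamma)
  then show ?thesis
    using assms by (simp add: curvature_gamma_add curvature_gamma_diff curvature_beta_zero closed)
qed

text \<open>Since D\<eta> vanishes on \<beta>Z, the vertical section is -D_{\<beta>Z}X minus
  \<open>hat\<close> of P at (Z, X), by antisymmetry of K. Since \<rho> vanishes on \<gamma>X, the
  horizontal one is D_{\<gamma>X}Z - T(X, Z).\<close>

lemma curvature_lie_bracket_gamma_beta: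
  assumes "pi_vector_field M X" "pi_vector_field M Z" "vector_field N C" "pi_vector_field M W" "u \<in> points N"
  shows "K (lie_bracket N (\<gamma> X) (\<beta> Z)) C W u =
    - K (\<gamma> (K (\<beta> Z) (\<gamma> X) eta)) C W u - K (\<gamma> (cov D (\<beta> Z) X)) C W u +
    K (\<beta> (cov D (\<gamma> X) Z)) C W u - K (\<beta> (torsion M D (\<gamma> X) (\<beta> Z))) C W u"
proof -
  note v = vector_field_gamma[OF assms(1)] vector_field_beta[OF assms(2)]
  \<comment> \<open>The leading 0 keeps the section a difference, so that
    \<open>curvature_gamma_diff\<close> can split it; this is why \<open>diff_0\<close> is removed
    from the simplifier below.\<close>
  have a: "cov D (lie_bracket N (\<gamma> X) (\<beta> Z)) eta u = (0 - K (\<beta> Z) (\<gamma> X) eta - cov D (\<beta> Z) X) u"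
    if "u \<in> points N" for u
    using cov_lie_bracket_eta[OF assms(1) cov_gamma_eta[OF assms(1)] pi_vector_field_zero _ v that]
      curvature_antisym[OF pi_vector_field_eta v that] that
    by (simp add: cov_beta_eta assms cov_zero_right v)
  have r: "rho_field M (lie_bracket N (\<gamma> X) (\<beta> Z)) u =
      (cov D (\<gamma> X) Z - torsion M D (\<gamma> X) (\<beta> Z)) u" if "u \<in> points N" for u
    using rho_lie_bracket[OF pi_vector_field_zero _ assms(2) rho_beta[OF assms(2)] v that] that
    by (simp add: rho_gamma assms cov_zero_right v)
  have "K (lie_bracket N (\<gamma> X) (\<beta> Z)) C W u =
      K (\<gamma> (0 - K (\<beta> Z) (\<gamma> X) eta - cov D (\<beta> Z) X)) C W u +
      K (\<beta> (cov D (\<gamma> X) Z - torsion M D (\<gamma> X) (\<beta> Z))) C W u"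
    by (rule curvature_decomposition[where a = "0 - K (\<beta> Z) (\<gamma> X) eta - cov D (\<beta> Z) X"
          and r = "cov D (\<gamma> X) Z - torsion M D (\<gamma> X) (\<beta> Z)", OF _ _ _ _ _ a _ r])
      (use assms v in \<open>simp_all add: closed del: diff_0\<close>)
  moreover have "K (\<gamma> 0) C W u = 0"
    using curvature_gamma_diff[OF pi_vector_field_zero pi_vector_field_zero assms(3-5)] by simp
  ultimately show ?thesis
    using assms by (simp add: curvature_gamma_diff curvature_beta_diff closed del: diff_0)
qed

lemma curvature_lie_bracket_beta_gamma:
  assumes "pi_vector_field M X" "pi_vector_field M Z" "vector_field N C" "pi_vector_field M W" "u \<in> points N"
  shows "K (lie_bracket N (\<beta> Z) (\<gamma> X)) C W u =
    K (\<gamma> (K (\<beta> Z) (\<gamma> X) eta)) C W u + K (\<gamma> (cov D (\<beta> Z) X)) C W u -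
    K (\<beta> (cov D (\<gamma> X) Z)) C W u + K (\<beta> (torsion M D (\<gamma> X) (\<beta> Z))) C W u"
  using curvature_uminus_left[OF assms(4) vector_field_bracket[OF vector_field_gamma[OF assms(1)]
        vector_field_beta[OF assms(2)]] assms(3,5)] curvature_lie_bracket_gamma_beta[OF assms]
  by (simp add: slit.lie_bracket_antisym[of "\<beta> Z" "\<gamma> X"])

text \<open>D\<eta> vanishes on both fields, so the vertical section is \<open>hat\<close> of R
  alone; the projection contributes Q.\<close>

lemma curvature_lie_bracket_beta_beta:
  assumes "pi_vector_field M X" "pi_vector_field M Y" "vector_field N C" "pi_vector_field M W" "u \<in> points N"
  shows "K (lie_bracket N (\<beta> X) (\<beta> Y)) C W u =
    K (\<gamma> (K (\<beta> X) (\<beta> Y) eta)) C W u +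
    K (\<beta> (cov D (\<beta> X) Y)) C W u - K (\<beta> (cov D (\<beta> Y) X)) C W u -
    K (\<beta> (torsion M D (\<beta> X) (\<beta> Y))) C W u"
proof -
  note v = vector_field_beta[OF assms(1)] vector_field_beta[OF assms(2)]
  have a: "cov D (lie_bracket N (\<beta> X) (\<beta> Y)) eta u = K (\<beta> X) (\<beta> Y) eta u"
    if "u \<in> points N" for u
    using cov_lie_bracket_eta[OF pi_vector_field_zero _ pi_vector_field_zero _ v that] that
    by (simp add: cov_beta_eta assms cov_zero_right v)
  note r = rho_lie_bracket[OF assms(1) rho_beta[OF assms(1)] assms(2) rho_beta[OF assms(2)] v]
  have "K (lie_bracket N (\<beta> X) (\<beta> Y)) C W u = K (\<gamma> (K (\<beta> X) (\<beta> Y) eta)) C W u +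
      K (\<beta> (cov D (\<beta> X) Y - cov D (\<beta> Y) X - torsion M D (\<beta> X) (\<beta> Y))) C W u"
    by (rule curvature_decomposition[where r = "cov D (\<beta> X) Y - cov D (\<beta> Y) X - torsion M D (\<beta> X) (\<beta> Y)",
          OF _ _ _ _ _ a _ r]) (use assms v in \<open>simp_all add: closed\<close>)
  then show ?thesis
    using assms by (simp add: curvature_beta_diff closed)
qed

text \<open>The cyclic sum contains derivatives of K(\<gamma>Y, \<beta>Z), while P is defined with
  the horizontal argument in front.\<close>

lemma cov_curvature_antisym:
  assumes "vector_field N A" "vector_field N B" "vector_field N C" "pi_vector_field M W" "u \<in> points N"
  shows "cov D A (K B C W) u = - cov D A (K C B W) u"
proof -
  note p = pi_vector_field_curvature[OF assms(3,2,4)]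
  have "cov D A (K B C W) u = cov D A (- K C B W) u"
    by (rule cov_cong_right[OF pi_vector_field_curvature[OF assms(2,3,4)] _ assms(1,5)])
      (simp add: curvature_antisym[OF assms(4,2,3)])
  then show ?thesis using cov_uminus_right[OF assms(1) p assms(5)] by simp
qed

lemma bianchi_vvv:
  assumes "pi_vector_field M X" "pi_vector_field M Y" "pi_vector_field M Z" "pi_vector_field M W"
    "u \<in> points N"
  shows "cyclic_sum (\<lambda>X Y Z. cov_tensor D (\<gamma> X) (v_curvature M D) Y Z W -
    v_curvature M D (hat (v_curvature M D) X Y) Z W) X Y Z u = 0"
proof -
  note c = assms closed
  note anti = curvature_antisym[OF assms(4) _ _ assms(5)]
  show ?thesis
    \<comment> \<open>The brackets put derivatives such as D_{\<gamma>X}Z into the first slot of K,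
      the corrections in the derivative of S also into the second. One instance of antisymmetry per
      derivative aligns them; the general rule would loop.\<close>
    using second_bianchi[of "\<gamma> X" "\<gamma> Y" "\<gamma> Z" W u]
      anti[of "\<gamma> X" "\<gamma> (cov D (\<gamma> Y) Z)"] anti[of "\<gamma> Y" "\<gamma> (cov D (\<gamma> Z) X)"]
      anti[of "\<gamma> Z" "\<gamma> (cov D (\<gamma> X) Y)"] anti[of "\<gamma> X" "\<gamma> (cov D (\<gamma> Z) Y)"]
      anti[of "\<gamma> Y" "\<gamma> (cov D (\<gamma> X) Z)"] anti[of "\<gamma> Z" "\<gamma> (cov D (\<gamma> Y) X)"]
    by (simp add: cyclic_sum_def cov_tensor_def v_curvature_def hat_def c
        curvature_lie_bracket_gamma_gamma algebra_simps)
qed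

text \<open>The bracket of \<gamma>X and \<gamma>Y, paired with \<beta>Z, gives the term with
  \<open>hat S\<close>; each mixed bracket, paired with the remaining vertical field, gives one term
  with T and one with \<open>hat P\<close>.\<close>

lemma bianchi_vvh:
  assumes "pi_vector_field M X" "pi_vector_field M Y" "pi_vector_field M Z" "pi_vector_field M W"
    "u \<in> points N"
  defines "P \<equiv> hv_curvature M D" and "S \<equiv> v_curvature M D" and "T \<equiv> hv_torsion M D"
  shows "(cov_tensor D (\<beta> Z) S X Y W - cov_tensor D (\<gamma> X) P Z Y W + cov_tensor D (\<gamma> Y) P Z X W) u
    = (P (T X Z) Y W - P (T Y Z) X W - P Z (hat S X Y) W + S (hat P Z X) Y W - S (hat P Z Y) X W) u"
proof -
  note c = assms(1-5) closed
  note anti = curvature_antisym[OF assms(4) _ _ assms(5)]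
  show ?thesis
    using second_bianchi[of "\<gamma> X" "\<gamma> Y" "\<beta> Z" W u]
    \<comment> \<open>Antisymmetry is restricted to a vertical argument before a horizontal one,
      which orients it towards P and prevents loops. The one pair of vertical arguments to be
      exchanged is supplied as an instance.\<close>
    by (simp add: P_def S_def T_def cov_tensor_def v_curvature_def hv_curvature_def hv_torsion_def hat_def c
        curvature_lie_bracket_gamma_gamma curvature_lie_bracket_gamma_beta
        curvature_lie_bracket_beta_gamma algebra_simps
        cov_curvature_antisym[of _ "\<gamma> _" "\<beta> _"] curvature_antisym[of _ "\<gamma> _" "\<beta> _"]
        anti[of "\<gamma> X" "\<gamma> (cov D (\<beta> Z) Y)"])
qed

text \<open>The bracket of \<beta>Y and \<beta>Z, paired with \<gamma>X, gives the terms with Q and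
  \<open>hat R\<close>; each mixed bracket, paired with the other horizontal field, gives one term
  with T and one with \<open>hat P\<close>.\<close>

lemma bianchi_vhh:
  assumes "pi_vector_field M X" "pi_vector_field M Y" "pi_vector_field M Z" "pi_vector_field M W"
    "u \<in> points N"
  defines "P \<equiv> hv_curvature M D" and "S \<equiv> v_curvature M D" and "R \<equiv> h_curvature M D"
    and "T \<equiv> hv_torsion M D" and "Q \<equiv> h_torsion M D"
  shows "(cov_tensor D (\<gamma> X) R Y Z W + cov_tensor D (\<beta> Y) P Z X W - cov_tensor D (\<beta> Z) P Y X W) u
    = (P Z (hat P Y X) W - P Y (hat P Z X) W - P (Q Y Z) X W
      + R (T X Z) Y W - R (T X Y) Z W + S (hat R Y Z) X W) u"
proof -
  note c = assms(1-5) closed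
  note anti = curvature_antisym[OF assms(4) _ _ assms(5)]
  show ?thesis
    using second_bianchi[of "\<gamma> X" "\<beta> Y" "\<beta> Z" W u]
      anti[of "\<beta> Y" "\<beta> (cov D (\<gamma> X) Z)"]
    by (simp add: P_def S_def T_def R_def Q_def cov_tensor_def v_curvature_def hv_curvature_def
        h_curvature_def h_torsion_def hv_torsion_def hat_def c
        curvature_lie_bracket_beta_beta curvature_lie_bracket_gamma_beta
        curvature_lie_bracket_beta_gamma algebra_simps
        cov_curvature_antisym[of _ "\<gamma> _" "\<beta> _"] curvature_antisym[of _ "\<gamma> _" "\<beta> _"])
qed

text \<open>Each bracket of two horizontal fields contributes \<open>hat R\<close> vertically and Q
  horizontally. Exchanging the arguments of K to obtain P gives the \<open>hat R\<close> term the
  same sign as the Q term.\<close>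

lemma bianchi_hhh:
  assumes "pi_vector_field M X" "pi_vector_field M Y" "pi_vector_field M Z" "pi_vector_field M W"
    "u \<in> points N"
  shows "cyclic_sum (\<lambda>X Y Z. cov_tensor D (\<beta> X) (h_curvature M D) Y Z W +
    hv_curvature M D X (hat (h_curvature M D) Y Z) W +
    h_curvature M D (h_torsion M D X Y) Z W) X Y Z u = 0"
proof -
  note c = assms closed
  note anti = curvature_antisym[OF assms(4) _ _ assms(5)]
  show ?thesis
    using second_bianchi[of "\<beta> X" "\<beta> Y" "\<beta> Z" W u]
      anti[of "\<beta> X" "\<beta> (cov D (\<beta> Y) Z)"] anti[of "\<beta> Y" "\<beta> (cov D (\<beta> Z) X)"]
      anti[of "\<beta> Z" "\<beta> (cov D (\<beta> X) Y)"] anti[of "\<beta> X" "\<beta> (cov D (\<beta> Z) Y)"]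
      anti[of "\<beta> Y" "\<beta> (cov D (\<beta> X) Z)"] anti[of "\<beta> Z" "\<beta> (cov D (\<beta> Y) X)"]
    by (simp add: cyclic_sum_def cov_tensor_def h_curvature_def hv_curvature_def h_torsion_def hat_def c
        curvature_lie_bracket_beta_beta curvature_antisym[of _ "\<gamma> _" "\<beta> _"] algebra_simps)
qed

end

theorem proposition2p6:
  fixes M :: "('a, 'i, 'e::euclidean_space) charted_set"
    and D :: "('a, 'i, 'e) pi_operator"
    and X Y Z W :: "('a, 'i, 'e) pi_section"
  assumes "paracompact_smooth_manifold M"
    and "regular_connection M D"
    and "\<And>X u. pi_vector_field M X \<Longrightarrow> u \<in> points (slit_tangent_bundle M) \<Longrightarrow>
           hv_torsion M D X eta u = 0"
    and "pi_vector_field M X" "pi_vector_field M Y" "pi_vector_field M Z" "pi_vector_field M W"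
  shows "let \<gamma> = gamma_field M; \<beta> = beta_field M D;
             Q = h_torsion M D; T = hv_torsion M D;
             R = h_curvature M D; P = hv_curvature M D; S = v_curvature M D;
             DD = cov_tensor D
         in \<forall>u\<in>points (slit_tangent_bundle M).
     (cyclic_sum (\<lambda>X Y Z. DD (\<gamma> X) S Y Z W - S (hat S X Y) Z W) X Y Z) u = 0
   \<and> (DD (\<beta> Z) S X Y W - DD (\<gamma> X) P Z Y W + DD (\<gamma> Y) P Z X W) u
     = (P (T X Z) Y W - P (T Y Z) X W - P Z (hat S X Y) W
         + S (hat P Z X) Y W - S (hat P Z Y) X W) u
   \<and> (DD (\<gamma> X) R Y Z W + DD (\<beta> Y) P Z X W - DD (\<beta> Z) P Y X W) u
     = (P Z (hat P Y X) W - P Y (hat P Z X) W - P (Q Y Z) X W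
         + R (T X Z) Y W - R (T X Y) Z W + S (hat R Y Z) X W) u
   \<and> (cyclic_sum (\<lambda>X Y Z. DD (\<beta> X) R Y Z W + P X (hat R Y Z) W + R (Q X Y) Z W) X Y Z) u = 0"
proof -
  interpret eta_torsion_free_connection M D
    by unfold_locales (use assms in \<open>auto simp: paracompact_smooth_manifold_def\<close>)
  show ?thesis
    unfolding Let_def
    by (intro ballI conjI bianchi_vvv bianchi_vvh bianchi_vhh bianchi_hhh assms(4-7))
qed

end
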